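(* Suppose the interventional faithfulness assumption, the ancestrality gap assumption with constant $\epsilon>0$, the confounder gap assumption with constant $\gamma>0$, and the positivity assumption with constant $\eta>0$ (all stated in the context) hold. Let $d_{max}$ be at least the maximum degree of the observable graph, let $n$ be the number of nodes of the causal graph, and $$A=\max\Big(\tfrac{8}{\epsilon^2},\tfrac{8}{\gamma^2}\Big)\log\tfrac{2nK^2}{\delta_1},\quad B=\tfrac{8}{\epsilon^2}\log\tfrac{2nK^2}{\delta_2},\quad C=\tfrac{16}{\eta\gamma^2}\log\tfrac{2n^2K^2}{\delta_3}+\tfrac{1}{2\eta^2}\log\tfrac{2n^2K^2}{\delta_4}.$$ Then the algorithm LearnCausalGraph$(\alpha,d_{max},\delta_1,\delta_2,\delta_3,\delta_4)$ described in the context learns the true causal graph with latents (bidirected edges) with probability at least $$1-\frac{2}{n^{\frac{\alpha}{2d_{max}}-2}}-8\alpha d_{max}\log(n)\,\big(n\delta_1+(\delta_2+\delta_3+\delta_4)\big),$$ with a maximum of $8\alpha d_{max}\log(n)\,(KAn+\max(B,C))$ interventional samples. If one sets $\alpha=\frac{2d_{max}\log(\frac{4}{\delta}+2)}{\log n}$, $\delta_1=\frac{\delta}{64\alpha d_{max}n\log n}$ and $\delta_2=\delta_3=\delta_4=\frac{\delta}{64\alpha d_{max}\log n}$, then the algorithm learns the true causal graph with probability at least $1-\delta$.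
   Context: Setup. A structural causal model (SCM) has a finite set $\mathbf{V}$ of observed discrete variables with values in $[K]=\{1,\dots,K\}$ (a reward variable $Y\in\mathbf{V}$ is binary), independent exogenous variables, and structural equations $V_i=f_i(\mathsf{Pa}(V_i),\mathbf{U}_i)$, $\mathbf{U}_i$ a set of exogenous variables. It is semi-Markovian: every unobserved variable has no parents and exactly two children, both observed. Its causal graph $\mathcal{G}$ has vertex set $\mathbf{V}$, acyclic directed edges from parents to children, and a bidirected edge $V_i\leftrightarrow V_j$ whenever $V_i,V_j$ share an unobserved variable (latent confounder). The observable graph is the graph of directed edges only. $\mathsf{Pa},\mathsf{An}$ denote parents and ancestors. $do(\mathbf{W}=\mathbf{w})$ is a hard intervention; $\mathcal{G}_{\overline{\mathbf{W}}}$ is $\mathcal{G}$ with all edges into $\mathbf{W}$ removed. $\widehat P$ denotes empirical estimates computed from the samples. Interventional faithfulness: consider a set of nodes $\mathbf{W}\subseteq\mathbf{V}$ and the stochastic intervention $do(\mathbf{W},\mathbf{U})$ on $\mathbf{W}$ and any set $\mathbf{U}\subseteq\mathbf{V}\setminus\mathbf{W}$. For disjoint subsets $\mathbf{X},\mathbf{Y},\mathbf{Z}$ of $\mathbf{V}\setminus\mathbf{W}$, the conditional independence of $\mathbf{X}$ and $\mathbf{Y}$ given $\mathbf{Z}$ holds in the induced model $\mathcal{M}_{\mathbf{W},\mathbf{U}}$ (with respect to the post-interventional joint distribution) if and only if $\mathbf{X}$ and $\mathbf{Y}$ are d-separated by $\mathbf{Z}$ in the post-interventional graph $\mathcal{G}_{\overline{\mathbf{W},\mathbf{U}}}$.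 Ancestrality gap assumption: for $\mathbf{W}\subseteq\mathbf{V}$ and any two variables $X,T\in\mathbf{V}\setminus\mathbf{W}$, $X$ is an ancestor of $T$ in $\mathcal{G}_{\overline{\mathbf{W}}}$ if and only if for any $\mathbf{w}\in[K]^{|\mathbf{W}|}$ we have $|P(t\mid do(\mathbf{w}))-P(t\mid do(\mathbf{w}),do(x))|>\epsilon$ for some $x,t\in[K]$. Confounder gap assumption: for two variables $X_i,X_j$ with $X_j\notin\mathsf{An}(X_i)$ and a set $\mathbf{W}$ with $(\mathsf{Pa}(X_i)\cup\mathsf{Pa}(X_j))\setminus\{X_i\}\subseteq\mathbf{W}$ and $X_i,X_j\notin\mathbf{W}$, there is a latent confounder between $X_i$ and $X_j$ if and only if for any $\mathbf{w}\in[K]^{|\mathbf{W}|}$ we have $|P(x_j\mid do(x_i),do(\mathbf{w}))-P(x_j\mid x_i,do(\mathbf{w}))|>\gamma$ for some $x_i,x_j\in[K]$. Positivity assumption: for every $X_i\in\mathbf{V}$, value $x_i$ and intervention $do(\mathbf{W}=\mathbf{w})$, either $P(x_i\mid do(\mathbf{w}))=0$ or $P(x_i\mid do(\mathbf{w}))\ge\eta$. Algorithms. The transitive closure of a graph has edge $V_i\to V_j$ iff $V_i$ is an ancestor of $V_j$; the transitive reduction of a DAG is the unique graph with fewest edges having the same transitive closure. LearnTransitiveClosure$(\mathbf{V},\mathbf{W},\delta_1,\delta_2)$: fix some $\mathbf{w}\in[K]^{|\mathbf{W}|}$; draw $B$ samples from $do(\mathbf{W}=\mathbf{w})$ and $A$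 samples from each $do(X_i=x_i,\mathbf{W}=\mathbf{w})$, $X_i\in\mathbf{V}\setminus\mathbf{W}$, $x_i\in[K]$; for every pair $X_i,X_j\in\mathbf{V}\setminus\mathbf{W}$ include the edge $(X_i,X_j)$ iff $|\widehat P(x_j\mid do(\mathbf{w}))-\widehat P(x_j\mid do(\mathbf{w}),do(x_i))|>\epsilon/2$ for some $x_i,x_j\in[K]$. Return the graph and all the data. LearnObservableGraph$(\mathbf{V},\alpha,d_{max},\delta_1,\delta_2)$: start with no edges; for $8\alpha d_{max}\log n$ iterations, form a random set $\mathbf{W}$ containing each vertex independently with probability $1-\frac{1}{2d_{max}}$, run LearnTransitiveClosure$(\mathbf{V},\mathbf{W},\delta_1,\delta_2)$, compute the transitive reduction of the returned graph, add its edges to the edge set, and store the data. Return the graph and all stored data. LearnCausalGraph$(\alpha,d_{max},\delta_1,\dots,\delta_4)$: run LearnObservableGraph. For every pair $X_i,X_j\in\mathbf{V}$ (swapped if $X_j\in\mathsf{An}(X_i)$): find in the stored data the data sets for $do(\mathbf{W}=\mathbf{w})$ and $do(X_i=x_i,\mathbf{W}=\mathbf{w})$ with $(\mathsf{Pa}(X_i)\cup\mathsf{Pa}(X_j))\setminus\{X_i\}\subseteq\mathbf{W}$ and $X_i,X_j\notin\mathbf{W}$; get $\max(0,C-B)$ new samples from $do(\mathbf{W}=\mathbf{w})$; add the bidirected edge $X_i\leftrightarrow X_j$ iff $|\widehat P(x_j\mid do(x_i),do(\mathbf{w}))-\widehat P(x_j\mid x_i,do(\mathbf{w}))|>\gamma/2$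 for some $x_i,x_j\in[K]$. Return the resulting graph.
   Formalization: The printed α makes the last claim false; α = 2 d_max (log(4/δ)/log n + 2) is used, with n ≥ 2, 0 < δ < 1. A, B, C are rounded up, the iteration count down; each data set gets its max(0, C−B) new samples at most once, as the sample bound requires. *)

theory Defs
  imports "HOL-Probability.Probability" "HOL-Probability.Product_PMF"
begin

section \<open>Semi-Markovian structural causal models\<close>

text \<open>
  \<open>noise u\<close> is the distribution of the exogenous variable \<open>u\<close>; the exogenous variables are
  independent, so their joint distribution is the product measure. \<open>eqn i\<close> is only ever applied
  to arguments restricted to \<open>pa i\<close> and \<open>exo_of i\<close>.
\<close>

record ('v, 'u, 'e) scm =
  obs :: "'v set"
  dom_size :: nat
  pa :: "'v \<Rightarrow> 'v set"
  exo :: "'u set"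
  exo_of :: "'v \<Rightarrow> 'u set"
  noise :: "'u \<Rightarrow> 'e measure"
  eqn :: "'v \<Rightarrow> ('v \<Rightarrow> nat) \<Rightarrow> ('u \<Rightarrow> 'e) \<Rightarrow> nat"

abbreviation vals :: "('v, 'u, 'e, 'm) scm_scheme \<Rightarrow> nat set" where
  "vals M \<equiv> {1..dom_size M}"

abbreviation assignments :: "('v, 'u, 'e, 'm) scm_scheme \<Rightarrow> 'v set \<Rightarrow> ('v \<Rightarrow> nat) set" where
  "assignments M W \<equiv> W \<rightarrow>\<^sub>E vals M"

abbreviation exo_measure :: "('v, 'u, 'e, 'm) scm_scheme \<Rightarrow> ('u \<Rightarrow> 'e) measure" where
  "exo_measure M \<equiv> Pi\<^sub>M (exo M) (noise M)"

definition observable_graph :: "('v, 'u, 'e, 'm) scm_scheme \<Rightarrow> ('v \<times> 'v) set" where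
  "observable_graph M = {(j, i). i \<in> obs M \<and> j \<in> pa M i}"

definition confounded :: "('v, 'u, 'e, 'm) scm_scheme \<Rightarrow> 'v \<Rightarrow> 'v \<Rightarrow> bool" where
  "confounded M i j \<longleftrightarrow> i \<noteq> j \<and> exo_of M i \<inter> exo_of M j \<noteq> {}"

text \<open>
  A mixed graph consists of its directed edges and its bidirected edges, the latter as
  two-element sets.
\<close>

type_synonym 'v mixed_graph = "('v \<times> 'v) set \<times> 'v set set"

definition causal_graph :: "('v, 'u, 'e, 'm) scm_scheme \<Rightarrow> 'v mixed_graph" where
  "causal_graph M =
     (observable_graph M, {{i, j} |i j. i \<in> obs M \<and> j \<in> obs M \<and> confounded M i j})"

text \<open>
  An exogenous variable with two children is an unobserved variable (latent confounder); one with a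
  single child is the private noise of the structural equation of that child. The two values of the
  binary reward variable \<open>Y\<close> are coded as \<open>1\<close> and \<open>2\<close>.
\<close>

definition semi_markovian_scm :: "('v, 'u, 'e, 'm) scm_scheme \<Rightarrow> 'v \<Rightarrow> bool" where
  "semi_markovian_scm M Y \<longleftrightarrow>
     finite (obs M) \<and>
     (\<forall>i\<in>obs M. pa M i \<subseteq> obs M \<and> exo_of M i \<subseteq> exo M) \<and>
     acyclic (observable_graph M) \<and>
     (\<forall>u\<in>exo M. prob_space (noise M u)) \<and>
     (\<forall>u\<in>exo M. card {i \<in> obs M. u \<in> exo_of M i} \<in> {1, 2}) \<and>
     (\<forall>i\<in>obs M. \<forall>a\<in>assignments M (pa M i).
        eqn M i a \<in> Pi\<^sub>M (exo_of M i) (noise M) \<rightarrow>\<^sub>M count_space (vals M)) \<and>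
     Y \<in> obs M \<and> 2 \<le> dom_size M \<and>
     (\<forall>a\<in>assignments M (pa M Y). \<forall>e\<in>space (Pi\<^sub>M (exo_of M Y) (noise M)). eqn M Y a e \<in> {1, 2})"


subsection \<open>Interventional distributions\<close>

definition solution ::
  "('v, 'u, 'e, 'm) scm_scheme \<Rightarrow> 'v set \<Rightarrow> ('v \<Rightarrow> nat) \<Rightarrow> ('u \<Rightarrow> 'e) \<Rightarrow> 'v \<Rightarrow> nat" where
  "solution M W w e =
     (THE x. x \<in> extensional (obs M) \<and>
        (\<forall>i\<in>obs M. x i =
           (if i \<in> W then w i else eqn M i (restrict x (pa M i)) (restrict e (exo_of M i)))))"

text \<open>The joint distribution \<open>P(\<cdot> | do(W = w))\<close> of the observed variables.\<close>

definition do_dist ::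
  "('v, 'u, 'e, 'm) scm_scheme \<Rightarrow> 'v set \<Rightarrow> ('v \<Rightarrow> nat) \<Rightarrow> ('v \<Rightarrow> nat) pmf" where
  "do_dist M W w =
     embed_pmf (\<lambda>x. measure (exo_measure M) {e \<in> space (exo_measure M). solution M W w e = x})"

definition do_prob ::
  "('v, 'u, 'e, 'm) scm_scheme \<Rightarrow> 'v set \<Rightarrow> ('v \<Rightarrow> nat) \<Rightarrow> 'v \<Rightarrow> nat \<Rightarrow> real" where
  "do_prob M W w i x = measure_pmf.prob (do_dist M W w) {v. v i = x}"

text \<open>\<open>P(X\<^sub>j = y | X\<^sub>i = x, do(W = w))\<close>; only meaningful if \<open>do_prob M W w i x > 0\<close>.\<close>

definition do_cond_prob ::
  "('v, 'u, 'e, 'm) scm_scheme \<Rightarrow> 'v set \<Rightarrow> ('v \<Rightarrow> nat) \<Rightarrow> 'v \<Rightarrow> nat \<Rightarrow> 'v \<Rightarrow> nat \<Rightarrow> real" where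
  "do_cond_prob M W w i x j y =
     measure_pmf.prob (do_dist M W w) {v. v i = x \<and> v j = y} / do_prob M W w i x"

text \<open>
  The stochastic intervention on \<open>S\<close> sets each \<open>i \<in> S\<close> to an independent random value drawn
  from \<open>q i\<close>.
\<close>

definition stochastic_do_dist ::
  "('v, 'u, 'e, 'm) scm_scheme \<Rightarrow> ('v \<Rightarrow> nat pmf) \<Rightarrow> 'v set \<Rightarrow> ('v \<Rightarrow> nat) pmf" where
  "stochastic_do_dist M q S = Pi_pmf S undefined q \<bind> do_dist M S"


subsection \<open>d-separation in mixed graphs\<close>

text \<open>All edges with an arrowhead into \<open>W\<close> are removed; this includes the bidirected edges at \<open>W\<close>.\<close>

definition remove_incoming :: "'v mixed_graph \<Rightarrow> 'v set \<Rightarrow> 'v mixed_graph" where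
  "remove_incoming G W = ({(i, j) \<in> fst G. j \<notin> W}, {e \<in> snd G. e \<inter> W = {}})"

datatype edge_kind = Forward | Backward | Bidirected

fun has_edge :: "'v mixed_graph \<Rightarrow> 'v \<Rightarrow> edge_kind \<Rightarrow> 'v \<Rightarrow> bool" where
  "has_edge G i Forward j \<longleftrightarrow> (i, j) \<in> fst G"
| "has_edge G i Backward j \<longleftrightarrow> (j, i) \<in> fst G"
| "has_edge G i Bidirected j \<longleftrightarrow> i \<noteq> j \<and> {i, j} \<in> snd G"

text \<open>
  A path visits \<open>vs ! 0, \<dots>, vs ! m\<close>; its \<open>k\<close>-th edge, between \<open>vs ! k\<close> and
  \<open>vs ! Suc k\<close>, is of kind \<open>es ! k\<close>. The kinds are recorded because two vertices may be joined
  by both a directed and a bidirected edge.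
\<close>

definition mixed_path :: "'v mixed_graph \<Rightarrow> 'v list \<Rightarrow> edge_kind list \<Rightarrow> bool" where
  "mixed_path G vs es \<longleftrightarrow>
     length vs = Suc (length es) \<and> distinct vs \<and>
     (\<forall>k<length es. has_edge G (vs ! k) (es ! k) (vs ! Suc k))"

text \<open>\<open>a\<close> and \<open>b\<close> are the kinds of the edges before and after the vertex.\<close>

definition collider :: "edge_kind \<Rightarrow> edge_kind \<Rightarrow> bool" where
  "collider a b \<longleftrightarrow> a \<noteq> Backward \<and> b \<noteq> Forward"

definition active_path :: "'v mixed_graph \<Rightarrow> 'v set \<Rightarrow> 'v list \<Rightarrow> edge_kind list \<Rightarrow> bool" where
  "active_path G Z vs es \<longleftrightarrow>
     mixed_path G vs es \<and>
     (\<forall>k. Suc k < length es \<longrightarrow>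
        (if collider (es ! k) (es ! Suc k) then \<exists>z\<in>Z. (vs ! Suc k, z) \<in> (fst G)\<^sup>*
         else vs ! Suc k \<notin> Z))"

definition d_separated :: "'v mixed_graph \<Rightarrow> 'v set \<Rightarrow> 'v set \<Rightarrow> 'v set \<Rightarrow> bool" where
  "d_separated G X Y Z \<longleftrightarrow>
     \<not> (\<exists>vs es. active_path G Z vs es \<and> hd vs \<in> X \<and> last vs \<in> Y)"

definition cond_indep :: "('v \<Rightarrow> nat) pmf \<Rightarrow> 'v set \<Rightarrow> 'v set \<Rightarrow> 'v set \<Rightarrow> bool" where
  "cond_indep p X Y Z \<longleftrightarrow>
     (let agree = (\<lambda>a S. {v. \<forall>i\<in>S. v i = a i}) in
      \<forall>a. measure_pmf.prob p (agree a (X \<union> Y \<union> Z)) * measure_pmf.prob p (agree a Z) =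
          measure_pmf.prob p (agree a (X \<union> Z)) * measure_pmf.prob p (agree a (Y \<union> Z)))"


section \<open>Assumptions\<close>

definition interventional_faithfulness ::
  "('v, 'u, 'e, 'm) scm_scheme \<Rightarrow> ('v \<Rightarrow> nat pmf) \<Rightarrow> bool" where
  "interventional_faithfulness M q \<longleftrightarrow>
     (\<forall>W U X Y Z. W \<subseteq> obs M \<longrightarrow> U \<subseteq> obs M - W \<longrightarrow>
        X \<subseteq> obs M - W \<longrightarrow> Y \<subseteq> obs M - W \<longrightarrow> Z \<subseteq> obs M - W \<longrightarrow>
        X \<inter> Y = {} \<longrightarrow> X \<inter> Z = {} \<longrightarrow> Y \<inter> Z = {} \<longrightarrow>
        (cond_indep (stochastic_do_dist M q (W \<union> U)) X Y Z \<longleftrightarrow>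
         d_separated (remove_incoming (causal_graph M) (W \<union> U)) X Y Z))"

definition ancestrality_gap :: "('v, 'u, 'e, 'm) scm_scheme \<Rightarrow> real \<Rightarrow> bool" where
  "ancestrality_gap M \<epsilon> \<longleftrightarrow>
     (\<forall>W X T. W \<subseteq> obs M \<longrightarrow> X \<in> obs M - W \<longrightarrow> T \<in> obs M - W \<longrightarrow> X \<noteq> T \<longrightarrow>
        ((X, T) \<in> (fst (remove_incoming (causal_graph M) W))\<^sup>+ \<longleftrightarrow>
         (\<forall>w\<in>assignments M W. \<exists>x\<in>vals M. \<exists>t\<in>vals M.
            \<bar>do_prob M W w T t - do_prob M (insert X W) (w(X := x)) T t\<bar> > \<epsilon>)))"

text \<open>
  In the gap below only those \<open>x\<close> count for which \<open>P(x\<^sub>j | x\<^sub>i, do(w))\<close> is defined.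
\<close>

definition confounder_gap :: "('v, 'u, 'e, 'm) scm_scheme \<Rightarrow> real \<Rightarrow> bool" where
  "confounder_gap M \<gamma> \<longleftrightarrow>
     (\<forall>i j W. i \<in> obs M \<longrightarrow> j \<in> obs M \<longrightarrow> i \<noteq> j \<longrightarrow> (j, i) \<notin> (observable_graph M)\<^sup>+ \<longrightarrow>
        W \<subseteq> obs M \<longrightarrow> (pa M i \<union> pa M j) - {i} \<subseteq> W \<longrightarrow> i \<notin> W \<longrightarrow> j \<notin> W \<longrightarrow>
        (confounded M i j \<longleftrightarrow>
         (\<forall>w\<in>assignments M W. \<exists>x\<in>vals M. \<exists>y\<in>vals M. do_prob M W w i x > 0 \<and>
            \<bar>do_prob M (insert i W) (w(i := x)) j y - do_cond_prob M W w i x j y\<bar> > \<gamma>)))"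

definition positivity :: "('v, 'u, 'e, 'm) scm_scheme \<Rightarrow> real \<Rightarrow> bool" where
  "positivity M \<eta> \<longleftrightarrow>
     (\<forall>i\<in>obs M. \<forall>x\<in>vals M. \<forall>W w. W \<subseteq> obs M \<longrightarrow> w \<in> assignments M W \<longrightarrow>
        do_prob M W w i x = 0 \<or> do_prob M W w i x \<ge> \<eta>)"

text \<open>Number of neighbours, i.e. in-degree plus out-degree for an acyclic graph.\<close>

definition vertex_degree :: "('v \<times> 'v) set \<Rightarrow> 'v \<Rightarrow> nat" where
  "vertex_degree G v = card {u. (u, v) \<in> G \<or> (v, u) \<in> G}"


section \<open>The learning algorithm\<close>

text \<open>
  The algorithm accesses the model only through the vertex set \<open>V\<close>, the number \<open>K\<close> of values and
  a sampler \<open>P\<close>, where \<open>P W w\<close> is the distribution of a sample from \<open>do(W = w)\<close>.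
  Its free choices are universally quantified parameters: \<open>c k W\<close> is the assignment of \<open>W\<close> fixed
  in the \<open>k\<close>-th iteration, and \<open>sel (i, j) I\<close> is the data set used for the pair \<open>(i, j)\<close> if
  \<open>I\<close> is the set of indices of the stored data sets that can be used.
\<close>

type_synonym 'v sampler = "'v set \<Rightarrow> ('v \<Rightarrow> nat) \<Rightarrow> ('v \<Rightarrow> nat) pmf"

text \<open>
  The data stored by one run: \<open>observed\<close> holds the samples from \<open>do(W = w)\<close> and
  \<open>intervened i x\<close> those from \<open>do(X\<^sub>i = x, W = w)\<close>, where \<open>W\<close> is \<open>target\<close> and \<open>w\<close> is
  \<open>target_val\<close>.
\<close>

record 'v data_set =
  target :: "'v set"
  target_val :: "'v \<Rightarrow> nat"
  observed :: "('v \<Rightarrow> nat) list"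
  intervened :: "'v \<Rightarrow> nat \<Rightarrow> ('v \<Rightarrow> nat) list"

definition sample_count :: "('v \<Rightarrow> nat) list \<Rightarrow> (('v \<Rightarrow> nat) \<Rightarrow> bool) \<Rightarrow> nat" where
  "sample_count xs Q = length (filter Q xs)"

definition emp_prob :: "('v \<Rightarrow> nat) list \<Rightarrow> 'v \<Rightarrow> nat \<Rightarrow> real" where
  "emp_prob xs j y = real (sample_count xs (\<lambda>v. v j = y)) / real (length xs)"

definition emp_cond_prob :: "('v \<Rightarrow> nat) list \<Rightarrow> 'v \<Rightarrow> nat \<Rightarrow> 'v \<Rightarrow> nat \<Rightarrow> real" where
  "emp_cond_prob xs i x j y =
     real (sample_count xs (\<lambda>v. v i = x \<and> v j = y)) / real (sample_count xs (\<lambda>v. v i = x))"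

text \<open>For a graph that is not acyclic some edge-minimal graph is chosen.\<close>

definition transitive_reduction :: "('v \<times> 'v) set \<Rightarrow> ('v \<times> 'v) set" where
  "transitive_reduction G = (ARG_MIN card H. H\<^sup>+ = G\<^sup>+)"

definition learn_transitive_closure ::
  "'v sampler \<Rightarrow> 'v set \<Rightarrow> nat \<Rightarrow> real \<Rightarrow> nat \<Rightarrow> nat \<Rightarrow> ('v set \<Rightarrow> 'v \<Rightarrow> nat) \<Rightarrow> 'v set \<Rightarrow>
     (('v \<times> 'v) set \<times> 'v data_set) pmf" where
  "learn_transitive_closure P V K \<epsilon> A B c W =
     do {
       obs_data \<leftarrow> replicate_pmf B (P W (c W));
       int_data \<leftarrow> Pi_pmf ((V - W) \<times> {1..K}) []
         (\<lambda>(i, x). replicate_pmf A (P (insert i W) ((c W)(i := x))));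
       return_pmf
         ({(i, j). i \<in> V - W \<and> j \<in> V - W \<and> i \<noteq> j \<and>
             (\<exists>x\<in>{1..K}. \<exists>y\<in>{1..K}.
                \<bar>emp_prob obs_data j y - emp_prob (int_data (i, x)) j y\<bar> > \<epsilon> / 2)},
          \<lparr>target = W, target_val = c W, observed = obs_data, intervened = curry int_data\<rparr>)
     }"

definition random_vertex_set :: "'v set \<Rightarrow> nat \<Rightarrow> 'v set pmf" where
  "random_vertex_set V dmax =
     map_pmf (\<lambda>b. {v \<in> V. b v}) (Pi_pmf V False (\<lambda>_. bernoulli_pmf (1 - 1 / (2 * real dmax))))"

primrec observable_graph_loop ::
  "'v sampler \<Rightarrow> 'v set \<Rightarrow> nat \<Rightarrow> real \<Rightarrow> nat \<Rightarrow> nat \<Rightarrow> (nat \<Rightarrow> 'v set \<Rightarrow> 'v \<Rightarrow> nat) \<Rightarrow> nat \<Rightarrow> nat \<Rightarrow>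
     (('v \<times> 'v) set \<times> 'v data_set list) pmf" where
  "observable_graph_loop P V K \<epsilon> A B c dmax 0 = return_pmf ({}, [])"
| "observable_graph_loop P V K \<epsilon> A B c dmax (Suc k) =
     do {
       (G, ds) \<leftarrow> observable_graph_loop P V K \<epsilon> A B c dmax k;
       W \<leftarrow> random_vertex_set V dmax;
       (H, d) \<leftarrow> learn_transitive_closure P V K \<epsilon> A B (c k) W;
       return_pmf (G \<union> transitive_reduction H, ds @ [d])
     }"

definition learn_observable_graph ::
  "'v sampler \<Rightarrow> 'v set \<Rightarrow> nat \<Rightarrow> real \<Rightarrow> nat \<Rightarrow> nat \<Rightarrow> (nat \<Rightarrow> 'v set \<Rightarrow> 'v \<Rightarrow> nat) \<Rightarrow> real \<Rightarrow> nat \<Rightarrow>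
     (('v \<times> 'v) set \<times> 'v data_set list) pmf" where
  "learn_observable_graph P V K \<epsilon> A B c \<alpha> dmax =
     observable_graph_loop P V K \<epsilon> A B c dmax
       (nat \<lfloor>8 * \<alpha> * real dmax * ln (real (card V))\<rfloor>)"

definition orient :: "('v \<times> 'v) set \<Rightarrow> 'v \<times> 'v \<Rightarrow> 'v \<times> 'v" where
  "orient G = (\<lambda>(i, j). if (j, i) \<in> G\<^sup>+ then (j, i) else (i, j))"

definition usable :: "('v \<times> 'v) set \<Rightarrow> 'v \<times> 'v \<Rightarrow> 'v data_set \<Rightarrow> bool" where
  "usable G = (\<lambda>(i, j) d.
     {u. (u, i) \<in> G \<or> (u, j) \<in> G} - {i} \<subseteq> target d \<and> i \<notin> target d \<and> j \<notin> target d)"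

definition usable_indices :: "('v \<times> 'v) set \<Rightarrow> 'v data_set list \<Rightarrow> 'v \<times> 'v \<Rightarrow> nat set" where
  "usable_indices G ds p = {k. k < length ds \<and> usable G p (ds ! k)}"

text \<open>
  As before, only those \<open>x\<close> count for which the empirical conditional probability is defined.
\<close>

definition confounder_test ::
  "nat \<Rightarrow> real \<Rightarrow> ('v \<Rightarrow> nat) list \<Rightarrow> (nat \<Rightarrow> ('v \<Rightarrow> nat) list) \<Rightarrow> 'v \<times> 'v \<Rightarrow> bool" where
  "confounder_test K \<gamma> xs int_data = (\<lambda>(i, j).
     \<exists>x\<in>{1..K}. \<exists>y\<in>{1..K}. sample_count xs (\<lambda>v. v i = x) > 0 \<and>
       \<bar>emp_prob (int_data x) j y - emp_cond_prob xs i x j y\<bar> > \<gamma> / 2)"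

definition num_samples :: "'v set \<Rightarrow> nat \<Rightarrow> 'v data_set \<Rightarrow> nat" where
  "num_samples V K d =
     length (observed d) + (\<Sum>i\<in>V - target d. \<Sum>x=1..K. length (intervened d i x))"

text \<open>
  The order on the vertices only serves to enumerate every unordered pair once. A stored data set
  is topped up with \<open>max 0 (C - B)\<close> new samples at most once, also if it is used for several
  pairs; note that \<open>C - B\<close> is truncated subtraction. A pair without usable data set gets no
  bidirected edge. The second component of the result is the total number of samples drawn.
\<close>

definition learn_causal_graph_sized ::
  "('v::linorder) sampler \<Rightarrow> 'v set \<Rightarrow> nat \<Rightarrow> real \<Rightarrow> real \<Rightarrow> nat \<Rightarrow> nat \<Rightarrow> nat \<Rightarrow>
     (nat \<Rightarrow> 'v set \<Rightarrow> 'v \<Rightarrow> nat) \<Rightarrow> ('v \<times> 'v \<Rightarrow> nat set \<Rightarrow> nat) \<Rightarrow> real \<Rightarrow> nat \<Rightarrow>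
     ('v mixed_graph \<times> nat) pmf" where
  "learn_causal_graph_sized P V K \<epsilon> \<gamma> A B C c sel \<alpha> dmax =
     do {
       (G, ds) \<leftarrow> learn_observable_graph P V K \<epsilon> A B c \<alpha> dmax;
       let pairs = {p \<in> orient G ` {(i, j). i \<in> V \<and> j \<in> V \<and> i < j}. usable_indices G ds p \<noteq> {}};
       let idx = (\<lambda>p. sel p (usable_indices G ds p));
       new_data \<leftarrow> Pi_pmf (idx ` pairs) []
         (\<lambda>k. replicate_pmf (C - B) (P (target (ds ! k)) (target_val (ds ! k))));
       return_pmf
         ((G, {{i, j} |i j. (i, j) \<in> pairs \<and>
                 confounder_test K \<gamma>
                   (observed (ds ! idx (i, j)) @ new_data (idx (i, j)))
                   (intervened (ds ! idx (i, j)) i) (i, j)}),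
          (\<Sum>d\<leftarrow>ds. num_samples V K d) + (\<Sum>k\<in>idx ` pairs. length (new_data k)))
     }"

text \<open>Sample sizes are rounded up to integers.\<close>

definition size_A :: "nat \<Rightarrow> nat \<Rightarrow> real \<Rightarrow> real \<Rightarrow> real \<Rightarrow> nat" where
  "size_A n K \<epsilon> \<gamma> \<delta>\<^sub>1 = nat \<lceil>max (8 / \<epsilon>\<^sup>2) (8 / \<gamma>\<^sup>2) * ln (2 * real n * (real K)\<^sup>2 / \<delta>\<^sub>1)\<rceil>"

definition size_B :: "nat \<Rightarrow> nat \<Rightarrow> real \<Rightarrow> real \<Rightarrow> nat" where
  "size_B n K \<epsilon> \<delta>\<^sub>2 = nat \<lceil>8 / \<epsilon>\<^sup>2 * ln (2 * real n * (real K)\<^sup>2 / \<delta>\<^sub>2)\<rceil>"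

definition size_C :: "nat \<Rightarrow> nat \<Rightarrow> real \<Rightarrow> real \<Rightarrow> real \<Rightarrow> real \<Rightarrow> nat" where
  "size_C n K \<gamma> \<eta> \<delta>\<^sub>3 \<delta>\<^sub>4 =
     nat \<lceil>16 / (\<eta> * \<gamma>\<^sup>2) * ln (2 * (real n)\<^sup>2 * (real K)\<^sup>2 / \<delta>\<^sub>3) +
          1 / (2 * \<eta>\<^sup>2) * ln (2 * (real n)\<^sup>2 * (real K)\<^sup>2 / \<delta>\<^sub>4)\<rceil>"

definition learn_causal_graph ::
  "('v::linorder) sampler \<Rightarrow> 'v set \<Rightarrow> nat \<Rightarrow> real \<Rightarrow> real \<Rightarrow> real \<Rightarrow>
     (nat \<Rightarrow> 'v set \<Rightarrow> 'v \<Rightarrow> nat) \<Rightarrow> ('v \<times> 'v \<Rightarrow> nat set \<Rightarrow> nat) \<Rightarrow>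
     real \<Rightarrow> nat \<Rightarrow> real \<Rightarrow> real \<Rightarrow> real \<Rightarrow> real \<Rightarrow> ('v mixed_graph \<times> nat) pmf" where
  "learn_causal_graph P V K \<epsilon> \<gamma> \<eta> c sel \<alpha> dmax \<delta>\<^sub>1 \<delta>\<^sub>2 \<delta>\<^sub>3 \<delta>\<^sub>4 =
     learn_causal_graph_sized P V K \<epsilon> \<gamma>
       (size_A (card V) K \<epsilon> \<gamma> \<delta>\<^sub>1) (size_B (card V) K \<epsilon> \<delta>\<^sub>2) (size_C (card V) K \<gamma> \<eta> \<delta>\<^sub>3 \<delta>\<^sub>4)
       c sel \<alpha> dmax"

end

theory Submission
  imports Defs
begin

text \<open>
  Suppose that every estimate made by the algorithm is within a quarter of the relevant gap. The
  gap assumptions give the positive answers of the tests. For the negative ones they only provide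
  a single assignment \<open>w\<close> without a gap, but the structural equations give exact equality for
  every \<open>w\<close>: intervening on a non-ancestor changes nothing, and without a confounder
  \<open>P(x\<^sub>j | x\<^sub>i, do(w)) = P(x\<^sub>j | do(x\<^sub>i), do(w))\<close> once all parents are fixed. So each iteration finds
  the transitive closure of the subgraph induced on \<open>V - W\<close>, whose reduction only contains true
  edges, and contains \<open>i \<rightarrow> j\<close> as soon as \<open>i, j \<notin> W\<close> and the other parents of \<open>j\<close> are in \<open>W\<close>.
  A fixed pair gets a usable data set in one iteration with probability at least
  \<open>(1 - 1/(2d))\<^bsup>2d\<^esup> (1/(2d))\<^sup>2 \<ge> 1/(16d\<^sup>2)\<close>, where \<open>d\<close> is the degree bound. It remains to sum the
  failure probabilities over pairs and iterations, using Hoeffding's inequality.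
\<close>

section \<open>Concentration of empirical estimates\<close>

text \<open>Each test compares two estimates and its threshold is half the gap; this is where the
  quarter comes from. Two quarter errors leave a true difference of zero at or below the threshold
  and a true gap above it. Two features of the algorithm obstruct plain Hoeffding bounds. The
  estimate of \<open>P(x_j | x_i, do(w))\<close> has a random denominator. The two summands of
  \<open>C\<close> answer this: the second makes \<open>x_i\<close> frequent enough in the sample,
  the first makes the conditional frequency accurate once it is. Moreover, the confounder tests
  reuse stored samples, selected in a way that depends on all the data. Nothing is therefore
  conditioned on the success of the first phase: for each iteration separately, stored samples and a
  hypothetical top-up are treated as one i.i.d. sample, whether or not the algorithm asks for that
  top-up. The exponent of \<open>n\<close> in the result is a product: a success chance of
  \<open>1 / (16 * d^2)\<close> times \<open>8 * \<alpha> * d * ln n\<close> iterations is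
  \<open>\<alpha> / (2 * d) * ln n\<close>, and the union over at most \<open>n^2\<close> pairs
  costs the \<open>- 2\<close>.\<close>

lemma bernoulli_mgf_le:
  fixes l q :: real
  assumes "0 \<le> l" "0 \<le> q"
  shows "q * exp (l * (1 - q)) + (1 - q) * exp (- l * q) \<le> exp (l\<^sup>2 / 8)"
proof -
  have pos: "1 + q * (exp l - 1) > 0"
    using assms by (intro add_pos_nonneg mult_nonneg_nonneg) auto
  have "q * exp (l * (1 - q)) + (1 - q) * exp (- l * q) = exp (- l * q) * (1 + q * (exp l - 1))"
    by (simp add: algebra_simps exp_diff exp_minus field_simps flip: exp_add)
  also have "\<dots> = exp (- l * q + ln (1 + q * (exp l - 1)))"
    using pos by (subst exp_add) simp
  also have "\<dots> \<le> exp (l\<^sup>2 / 8)"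
    using Hoeffdings_lemma_aux[OF assms] by simp
  finally show ?thesis .
qed

lemma nn_integral_exp_replicate_pmf:
  "(\<integral>\<^sup>+xs. ennreal (exp (sum_list (map f xs))) \<partial>replicate_pmf m p) =
     (\<integral>\<^sup>+x. ennreal (exp (f x)) \<partial>measure_pmf p) ^ m"
  by (induction m)
     (simp_all add: nn_integral_bind_pmf exp_add ennreal_mult nn_integral_cmult nn_integral_multc)

lemma sample_count_Nil [simp]: "sample_count [] Q = 0"
  and sample_count_Cons: "sample_count (x # xs) Q = of_bool (Q x) + sample_count xs Q"
  by (auto simp: sample_count_def)

text \<open>
  The exponential weight \<open>exp (l * S - l\<^sup>2 / 8 * N)\<close>, with \<open>N\<close> the number of samples in \<open>A\<close> and
  \<open>S\<close> the excess of those in \<open>B\<close>, is a supermartingale, so the random number \<open>N\<close> need not be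
  conditioned on.
\<close>

lemma conditional_hoeffding_upper:
  fixes p :: "('v \<Rightarrow> nat) pmf"
  assumes q: "measure_pmf.prob p {v. A v \<and> B v} = q * measure_pmf.prob p {v. A v}"
    and "0 \<le> q" "0 \<le> t"
  shows "measure_pmf.prob (replicate_pmf m p)
      {xs. r \<le> real (sample_count xs A) \<and>
           (q + t) * real (sample_count xs A) < real (sample_count xs (\<lambda>v. A v \<and> B v))}
    \<le> exp (- 2 * t\<^sup>2 * r)" (is "measure_pmf.prob _ ?S \<le> _")
proof -
  \<comment> \<open>The rate \<open>l = 4 * t\<close> maximises
    \<open>l * t - l\<^sup>2 / 8\<close>, with maximum \<open>2 * t\<^sup>2\<close>;
    \<open>f v\<close> is the contribution of the sample \<open>v\<close> to the logarithm of the
    weight.\<close>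
  define f where "f v = of_bool (A v) * (4 * t * (of_bool (B v) - q) - 2 * t\<^sup>2)" for v
  have f_sum: "sum_list (map f xs) =
      4 * t * (real (sample_count xs (\<lambda>v. A v \<and> B v)) - q * real (sample_count xs A))
        - 2 * t\<^sup>2 * real (sample_count xs A)" for xs
    by (induction xs) (auto simp: f_def sample_count_Cons algebra_simps)
  let ?P = "measure_pmf.prob p"
  define a where "a = ?P {v. A v}"
  have a: "0 \<le> a" "a \<le> 1"
    by (simp_all add: a_def)
  have compl: "?P {v. \<not> A v} = 1 - a"
    using measure_pmf.prob_compl[of "{v. A v}" p] by (simp add: a_def Compl_eq_Diff_UNIV[symmetric] Collect_neg_eq)
  have diff: "?P {v. A v \<and> \<not> B v} = a - q * a"
  proof -
    have "{v. A v} = {v. A v \<and> B v} \<union> {v. A v \<and> \<not> B v}" by auto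
    then have "a = ?P {v. A v \<and> B v} + ?P {v. A v \<and> \<not> B v}"
      unfolding a_def by (simp only:) (subst measure_pmf.finite_measure_Union, auto)
    then show ?thesis using q by (simp add: a_def)
  qed
  \<comment> \<open>\<open>u\<close> and \<open>d\<close> are the values of \<open>exp (f v)\<close>
    on the two parts of \<open>A\<close>; off \<open>A\<close> the value is 1. So the mean is at
    most 1 as soon as the average of \<open>u\<close> and \<open>d\<close> with weights
    \<open>q\<close> and \<open>1 - q\<close> is, and that is Hoeffding's lemma with
    \<open>l = 4 * t\<close>.\<close>
  define u where "u = exp (4 * t * (1 - q) - 2 * t\<^sup>2)"
  define d where "d = exp (- 4 * t * q - 2 * t\<^sup>2)"
  have "q * exp (4 * t * (1 - q)) + (1 - q) * exp (- (4 * t) * q) \<le> exp ((4 * t)\<^sup>2 / 8)"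
    using assms by (intro bernoulli_mgf_le) auto
  then have "(q * exp (4 * t * (1 - q)) + (1 - q) * exp (- (4 * t) * q)) * exp (- 2 * t\<^sup>2)
      \<le> exp ((4 * t)\<^sup>2 / 8) * exp (- 2 * t\<^sup>2)"
    by (intro mult_right_mono) auto
  then have ud: "q * u + (1 - q) * d \<le> 1"
    by (simp add: u_def d_def distrib_right power2_eq_square flip: exp_add)
       (simp add: exp_diff exp_minus field_simps exp_add)
  have int1: "(\<integral>\<^sup>+x. ennreal (exp (f x)) \<partial>measure_pmf p) \<le> 1"
  proof -
    have "(\<integral>\<^sup>+x. ennreal (exp (f x)) \<partial>measure_pmf p) =
       (\<integral>\<^sup>+x. (ennreal u * indicator {v. A v \<and> B v} x + ennreal d * indicator {v. A v \<and> \<not> B v} x)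
          + indicator {v. \<not> A v} x \<partial>measure_pmf p)"
      by (intro nn_integral_cong) (auto simp: f_def u_def d_def indicator_def)
    also have "\<dots> = ennreal u * ennreal (q * a) + ennreal d * ennreal (a - q * a) + ennreal (1 - a)"
      using q by (simp add: nn_integral_add nn_integral_cmult measure_pmf.emeasure_eq_measure compl diff a_def)
    also have "\<dots> = ennreal (u * (q * a) + d * (a - q * a) + (1 - a))"
      using a \<open>0 \<le> q\<close> diff[symmetric] by (simp add: u_def d_def flip: ennreal_mult' ennreal_plus)
    also have "u * (q * a) + d * (a - q * a) + (1 - a) = 1 - a * (1 - (q * u + (1 - q) * d))"
      by (simp add: algebra_simps)
    also have "ennreal \<dots> \<le> 1"
      using a ud by (simp add: ennreal_le_1)
    finally show ?thesis .
  qed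
  \<comment> \<open>Markov's inequality: on \<open>?S\<close> the exponent is at least
    \<open>4 * t * (t * N) - 2 * t\<^sup>2 * N = 2 * t\<^sup>2 * N\<close>, which is at least
    \<open>2 * t\<^sup>2 * r\<close>.\<close>
  have "emeasure (replicate_pmf m p) ?S = (\<integral>\<^sup>+xs. indicator ?S xs \<partial>replicate_pmf m p)"
    by simp
  also have "\<dots> \<le> (\<integral>\<^sup>+xs. ennreal (exp (- 2 * t\<^sup>2 * r)) * ennreal (exp (sum_list (map f xs)))
       \<partial>replicate_pmf m p)"
  proof (intro nn_integral_mono)
    fix xs
    show "indicator ?S xs \<le> ennreal (exp (- 2 * t\<^sup>2 * r)) * ennreal (exp (sum_list (map f xs)))"
    proof (cases "xs \<in> ?S")
      case True
      define N where "N = real (sample_count xs A)"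
      define S where "S = real (sample_count xs (\<lambda>v. A v \<and> B v))"
      have "4 * t * (t * N) \<le> 4 * t * (S - q * N)"
        using True \<open>0 \<le> t\<close> by (intro mult_left_mono) (auto simp: N_def S_def algebra_simps)
      moreover have "t\<^sup>2 * r \<le> t\<^sup>2 * N"
        using True by (intro mult_left_mono) (auto simp: N_def)
      ultimately have "0 \<le> - 2 * t\<^sup>2 * r + sum_list (map f xs)"
        by (simp add: f_sum power2_eq_square flip: N_def S_def)
      then have "1 \<le> exp (- 2 * t\<^sup>2 * r + sum_list (map f xs))" by simp
      then show ?thesis
        using True by (simp flip: ennreal_mult' exp_add)
    qed simp
  qed
  also have "\<dots> = ennreal (exp (- 2 * t\<^sup>2 * r)) * (\<integral>\<^sup>+x. ennreal (exp (f x)) \<partial>measure_pmf p) ^ m"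
    by (simp add: nn_integral_cmult nn_integral_exp_replicate_pmf)
  also have "\<dots> \<le> ennreal (exp (- 2 * t\<^sup>2 * r)) * 1 ^ m"
    using int1 by (intro mult_left_mono power_mono) auto
  finally show ?thesis
    by (simp add: measure_pmf.emeasure_eq_measure)
qed

text \<open>A deficit of \<open>B\<close> among the samples in \<open>A\<close> is an excess of its
  complement, whose conditional frequency is \<open>1 - q\<close>, so the one-sided bound is used
  twice. The form without division needs no exception for an empty count.\<close>

lemma conditional_hoeffding:
  fixes p :: "('v \<Rightarrow> nat) pmf"
  assumes q: "measure_pmf.prob p {v. A v \<and> B v} = q * measure_pmf.prob p {v. A v}"
    and "0 \<le> q" "q \<le> 1" "0 \<le> t"
  shows "measure_pmf.prob (replicate_pmf m p)
      {xs. r \<le> real (sample_count xs A) \<and> t * real (sample_count xs A) <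
           \<bar>real (sample_count xs (\<lambda>v. A v \<and> B v)) - q * real (sample_count xs A)\<bar>}
    \<le> 2 * exp (- 2 * t\<^sup>2 * r)" (is "measure_pmf.prob ?p ?S \<le> _")
proof -
  let ?U = "\<lambda>q B. {xs. r \<le> real (sample_count xs A) \<and>
           (q + t) * real (sample_count xs A) < real (sample_count xs (\<lambda>v. A v \<and> B v))}"
  have split: "sample_count xs A =
      sample_count xs (\<lambda>v. A v \<and> B v) + sample_count xs (\<lambda>v. A v \<and> \<not> B v)" for xs
    by (induction xs) (auto simp: sample_count_Cons)
  have "{v. A v} = {v. A v \<and> B v} \<union> {v. A v \<and> \<not> B v}" by auto
  then have "measure_pmf.prob p {v. A v} =
      measure_pmf.prob p {v. A v \<and> B v} + measure_pmf.prob p {v. A v \<and> \<not> B v}"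
    by (simp only:) (subst measure_pmf.finite_measure_Union, auto)
  then have q': "measure_pmf.prob p {v. A v \<and> \<not> B v} = (1 - q) * measure_pmf.prob p {v. A v}"
    using q by (simp add: algebra_simps)
  have "?S \<subseteq> ?U q B \<union> ?U (1 - q) (\<lambda>v. \<not> B v)"
    by (auto simp: split algebra_simps abs_if split: if_splits)
  then have "measure_pmf.prob ?p ?S \<le> measure_pmf.prob ?p (?U q B \<union> ?U (1 - q) (\<lambda>v. \<not> B v))"
    by (intro measure_pmf.finite_measure_mono) auto
  also have "\<dots> \<le> measure_pmf.prob ?p (?U q B) + measure_pmf.prob ?p (?U (1 - q) (\<lambda>v. \<not> B v))"
    by (intro measure_Un_le) auto
  also have "\<dots> \<le> exp (- 2 * t\<^sup>2 * r) + exp (- 2 * t\<^sup>2 * r)"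
    using assms q' by (intro add_mono conditional_hoeffding_upper) auto
  finally show ?thesis by simp
qed

lemma sample_count_True: "sample_count xs (\<lambda>_. True) = length xs"
  by (simp add: sample_count_def)

lemma emp_prob_deviation:
  assumes "0 \<le> t"
  shows "measure_pmf.prob (replicate_pmf m p)
      {xs. t < \<bar>emp_prob xs j y - measure_pmf.prob p {v. v j = y}\<bar>} \<le> 2 * exp (- 2 * t\<^sup>2 * real m)"
    (is "measure_pmf.prob ?p ?S \<le> _")
\<comment> \<open>Without samples the empirical probability is 0 by the convention for division by
  zero, but then the bound is 2. Otherwise the conditional bound applies with an event
  \<open>A\<close> that always holds and \<open>r = m\<close>.\<close>
proof (cases "m = 0")
  case True
  have "measure_pmf.prob ?p ?S \<le> 1" by simp
  moreover have "(1::real) \<le> 2 * exp (- 2 * t\<^sup>2 * real m)" using True by simp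
  ultimately show ?thesis by linarith
next
  case False
  let ?q = "measure_pmf.prob p {v. v j = y}"
  let ?S' = "{xs. real m \<le> real (sample_count xs (\<lambda>_. True)) \<and> t * real (sample_count xs (\<lambda>_. True)) <
           \<bar>real (sample_count xs (\<lambda>v. True \<and> v j = y)) - ?q * real (sample_count xs (\<lambda>_. True))\<bar>}"
  have "?S \<inter> set_pmf ?p \<subseteq> ?S'"
    using False by (auto simp: set_replicate_pmf emp_prob_def sample_count_True field_simps abs_if split: if_splits)
  then have "measure_pmf.prob ?p (?S \<inter> set_pmf ?p) \<le> measure_pmf.prob ?p ?S'"
    by (intro measure_pmf.finite_measure_mono) auto
  also have "\<dots> \<le> 2 * exp (- 2 * t\<^sup>2 * real m)"
    using assms by (intro conditional_hoeffding) auto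
  finally show ?thesis by (simp add: measure_Int_set_pmf)
qed

lemma sample_count_lower_tail:
  assumes "0 \<le> t"
  shows "measure_pmf.prob (replicate_pmf m p)
      {xs. real (sample_count xs A) < (measure_pmf.prob p {v. A v} - t) * real m}
    \<le> exp (- 2 * t\<^sup>2 * real m)" (is "measure_pmf.prob ?p ?S \<le> _")
proof -
  let ?S' = "{xs. real m \<le> real (sample_count xs (\<lambda>_. True)) \<and>
     (measure_pmf.prob p {v. \<not> A v} + t) * real (sample_count xs (\<lambda>_. True)) <
       real (sample_count xs (\<lambda>v. True \<and> \<not> A v))}"
  have split: "length xs = sample_count xs A + sample_count xs (\<lambda>v. \<not> A v)" for xs
    by (induction xs) (auto simp: sample_count_Cons)
  have compl: "measure_pmf.prob p {v. \<not> A v} = 1 - measure_pmf.prob p {v. A v}"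
    using measure_pmf.prob_compl[of "{v. A v}" p] by (simp add: Compl_eq_Diff_UNIV[symmetric] Collect_neg_eq)
  have "xs \<in> ?S'" if "xs \<in> ?S \<inter> set_pmf ?p" for xs
    using that split[of xs] by (auto simp: set_replicate_pmf sample_count_True compl algebra_simps)
  then have "measure_pmf.prob ?p (?S \<inter> set_pmf ?p) \<le> measure_pmf.prob ?p ?S'"
    by (intro measure_pmf.finite_measure_mono) auto
  also have "\<dots> \<le> exp (- 2 * t\<^sup>2 * real m)"
    using assms by (intro conditional_hoeffding_upper) auto
  finally show ?thesis by (simp add: measure_Int_set_pmf)
qed

text \<open>The failure event has two sources: too few samples with \<open>v i = x\<close>, which
  costs \<open>exp (- L')\<close>, and a wrong frequency among sufficiently many of them, which
  costs \<open>2 * exp (- L)\<close>. A null event is never sampled at all.\<close>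

lemma emp_cond_prob_deviation:
  fixes p :: "('v \<Rightarrow> nat) pmf" and i :: 'v and x :: nat and \<eta> \<gamma> L L' :: real
  defines "a \<equiv> measure_pmf.prob p {v. v i = x}"
  assumes "0 < \<eta>" "0 < \<gamma>" and a: "a = 0 \<or> \<eta> \<le> a"
    and m: "16 / (\<eta> * \<gamma>\<^sup>2) * L + 1 / (2 * \<eta>\<^sup>2) * L' \<le> real m"
  shows "measure_pmf.prob (replicate_pmf m p)
      {xs. if a = 0 then sample_count xs (\<lambda>v. v i = x) > 0
           else sample_count xs (\<lambda>v. v i = x) = 0 \<or>
             \<gamma> / 4 < \<bar>emp_cond_prob xs i x j y - measure_pmf.prob p {v. v i = x \<and> v j = y} / a\<bar>}
    \<le> 2 * exp (- L) + 2 * exp (- L')" (is "measure_pmf.prob ?p ?S \<le> _")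
proof -
  have le1: "measure_pmf.prob ?p ?S \<le> 1" by simp
  \<comment> \<open>A nonpositive \<open>L\<close> or \<open>L'\<close> makes the bound at least 1.
    This occurs when some \<delta> is so large that its logarithm is not positive.\<close>
  consider "a = 0" | "L \<le> 0" | "L' \<le> 0" | "\<eta> \<le> a" "0 < L" "0 < L'" "a \<noteq> 0"
    using a \<open>0 < \<eta>\<close> by linarith
  then show ?thesis
  proof cases
    case 1
    have "xs \<notin> ?S" if "xs \<in> set_pmf ?p" for xs
    proof -
      have "set xs \<subseteq> set_pmf p"
        using that by (auto simp: set_replicate_pmf in_lists_conv_set)
      moreover have "set_pmf p \<inter> {v. v i = x} = {}"
        using 1 by (simp add: a_def measure_pmf_zero_iff)
      ultimately show ?thesis
        using 1 by (auto simp: sample_count_def filter_empty_conv)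
    qed
    then have "measure_pmf.prob ?p ?S = 0"
      by (subst measure_pmf_zero_iff) blast
    then show ?thesis by simp
  next
    case 2
    then have "1 \<le> exp (- L)" by simp
    then show ?thesis using le1 exp_gt_zero[of "- L'"] by linarith
  next
    case 3
    then have "1 \<le> exp (- L')" by simp
    then show ?thesis using le1 exp_gt_zero[of "- L"] by linarith
  next
    case 4
    \<comment> \<open>\<open>D\<close> is the share of \<open>m\<close> paid for by
      \<open>L\<close>. A count of \<open>r\<close>, half of \<open>\<eta> * D\<close>, suffices for
      the frequency, since \<open>2 * (\<gamma> / 4)\<^sup>2 * r = L\<close>. The slack
      \<open>t\<close> is chosen such that \<open>(a - t) * real m = r\<close>.\<close>
    define D where "D = 16 / (\<eta> * \<gamma>\<^sup>2) * L"
    define r where "r = \<eta> * D / 2"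
    define t where "t = a - r / real m"
    have D: "0 < D" and m': "D + L' / (2 * \<eta>\<^sup>2) \<le> real m"
      using 4 assms by (auto simp: D_def)
    have "0 < L' / (2 * \<eta>\<^sup>2)" using 4 assms by simp
    then have Dm: "D < real m" and mpos: "0 < real m" using m' D by linarith+
    have r: "0 < r" using D assms by (simp add: r_def)
    have t_ge: "\<eta> * (1 - D / (2 * real m)) \<le> t"
      using 4 mpos by (simp add: t_def r_def field_simps)
    have nn: "0 \<le> \<eta> * (1 - D / (2 * real m))"
      using assms Dm mpos by (intro mult_nonneg_nonneg) (auto simp: field_simps)
    have "L' / 2 \<le> \<eta>\<^sup>2 * (real m - D)"
      using m' assms by (simp add: field_simps)
    \<comment> \<open>The squared factor times \<open>m\<close> expands to
      \<open>m - D + D\<^sup>2 / (4 * m)\<close>; the last term is dropped.\<close>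
    also have "\<dots> \<le> \<eta>\<^sup>2 * ((1 - D / (2 * real m))\<^sup>2 * real m)"
      using mpos D by (intro mult_left_mono) (auto simp: power2_eq_square field_simps zero_le_mult_iff)
    also have "\<dots> = (\<eta> * (1 - D / (2 * real m)))\<^sup>2 * real m"
      by (simp add: power_mult_distrib)
    also have "\<dots> \<le> t\<^sup>2 * real m"
      using t_ge nn by (intro mult_right_mono power_mono) auto
    finally have le: "exp (- 2 * t\<^sup>2 * real m) \<le> exp (- L')" by simp
    have lower: "measure_pmf.prob ?p {xs. real (sample_count xs (\<lambda>v. v i = x)) < (a - t) * real m}
        \<le> exp (- 2 * t\<^sup>2 * real m)"
      unfolding a_def using t_ge nn by (intro sample_count_lower_tail) linarith
    have "(a - t) * real m = r" using mpos by (simp add: t_def)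
    with order.trans[OF lower le]
    have tail: "measure_pmf.prob ?p {xs. real (sample_count xs (\<lambda>v. v i = x)) < r} \<le> exp (- L')"
      by (simp only:)
    let ?q = "measure_pmf.prob p {v. v i = x \<and> v j = y} / a"
    let ?N = "\<lambda>xs. real (sample_count xs (\<lambda>v. v i = x))"
    let ?D = "{xs. r \<le> ?N xs \<and> \<gamma> / 4 * ?N xs <
           \<bar>real (sample_count xs (\<lambda>v. v i = x \<and> v j = y)) - ?q * ?N xs\<bar>}"
    have "0 < a" using 4 assms by linarith
    moreover have "measure_pmf.prob p {v. v i = x \<and> v j = y} \<le> a"
      unfolding a_def by (intro measure_pmf.finite_measure_mono) auto
    ultimately have "measure_pmf.prob ?p ?D \<le> 2 * exp (- 2 * (\<gamma> / 4)\<^sup>2 * r)"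
      using assms by (intro conditional_hoeffding) (auto simp: a_def)
    also have "2 * (\<gamma> / 4)\<^sup>2 * r = L"
      using assms by (simp add: r_def D_def power2_eq_square)
    then have "- 2 * (\<gamma> / 4)\<^sup>2 * r = - L" by simp
    finally have dev: "measure_pmf.prob ?p ?D \<le> 2 * exp (- L)" .
    \<comment> \<open>Because \<open>r\<close> is positive, a count of at least \<open>r\<close> is
      not zero, so the clause about an empty count falls into the first set.\<close>
    have "?S \<subseteq> {xs. ?N xs < r} \<union> ?D"
    proof
      fix xs assume xs: "xs \<in> ?S"
      show "xs \<in> {xs. ?N xs < r} \<union> ?D"
      proof (cases "?N xs < r")
        case False
        then have N: "0 < ?N xs" using r by linarith
        then have *: "\<gamma> / 4 < \<bar>emp_cond_prob xs i x j y - ?q\<bar>"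
          using xs 4 by auto
        have "\<bar>real (sample_count xs (\<lambda>v. v i = x \<and> v j = y)) - ?q * ?N xs\<bar> =
            \<bar>(emp_cond_prob xs i x j y - ?q) * ?N xs\<bar>"
          using N by (simp add: emp_cond_prob_def left_diff_distrib)
        also have "\<dots> = \<bar>emp_cond_prob xs i x j y - ?q\<bar> * ?N xs"
          by (simp add: abs_mult)
        finally have "\<gamma> / 4 * ?N xs <
            \<bar>real (sample_count xs (\<lambda>v. v i = x \<and> v j = y)) - ?q * ?N xs\<bar>"
          using mult_strict_right_mono[OF * N] by simp
        then show ?thesis using False by simp
      qed simp
    qed
    then have "measure_pmf.prob ?p ?S \<le> measure_pmf.prob ?p ({xs. ?N xs < r} \<union> ?D)"
      by (intro measure_pmf.finite_measure_mono) auto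
    also have "\<dots> \<le> measure_pmf.prob ?p {xs. ?N xs < r} + measure_pmf.prob ?p ?D"
      by (intro measure_Un_le) auto
    finally show ?thesis
      using tail dev exp_gt_zero[of "- L'"] by linarith
  qed
qed

section \<open>Semi-Markovian models\<close>

lemma (in product_prob_space) measure_PiM_restrict_disjoint:
  assumes "J \<subseteq> I" "L \<subseteq> I" "J \<inter> L = {}"
    and A: "A \<in> sets (Pi\<^sub>M J M)" and B: "B \<in> sets (Pi\<^sub>M L M)"
  shows "measure (Pi\<^sub>M I M) {e \<in> space (Pi\<^sub>M I M). restrict e J \<in> A \<and> restrict e L \<in> B} =
    measure (Pi\<^sub>M I M) {e \<in> space (Pi\<^sub>M I M). restrict e J \<in> A} *
    measure (Pi\<^sub>M I M) {e \<in> space (Pi\<^sub>M I M). restrict e L \<in> B}"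
proof -
  interpret P: prob_space "Pi\<^sub>M I M"
    by (rule prob_space_PiM) (rule prob_space)
  have "P.indep_vars M (\<lambda>i e. e i) I"
  \<comment> \<open>The characterisation of independence by a product law is available for nonempty
    index sets; with no exogenous variables independence is vacuous.\<close>
  proof (cases "I = {}")
    case True
    have "P.indep_vars M (\<lambda>i e. e i) {}"
      by (simp add: P.indep_vars_def P.indep_sets_def)
    with True show ?thesis by simp
  next
    case False
    show ?thesis
    proof (subst P.indep_vars_iff_distr_eq_PiM')
    have "distr (Pi\<^sub>M I M) (Pi\<^sub>M I M) (\<lambda>x. \<lambda>i\<in>I. x i) = distr (Pi\<^sub>M I M) (Pi\<^sub>M I M) (\<lambda>x. x)"
      by (intro distr_cong refl) (auto simp: space_PiM PiE_iff extensional_restrict)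
    also have "\<dots> = (\<Pi>\<^sub>M i\<in>I. distr (Pi\<^sub>M I M) (M i) (\<lambda>e. e i))"
      by (auto intro!: PiM_cong simp: PiM_component distr_id2)
    finally show "distr (Pi\<^sub>M I M) (Pi\<^sub>M I M) (\<lambda>x. \<lambda>i\<in>I. x i) =
        (\<Pi>\<^sub>M i\<in>I. distr (Pi\<^sub>M I M) (M i) (\<lambda>e. e i))" .
    qed (use False in auto)
  qed
  from P.indep_var_restrict[OF this assms(3,1,2)]
  have "P.indep_var (Pi\<^sub>M J M) (\<lambda>e. restrict e J) (Pi\<^sub>M L M) (\<lambda>e. restrict e L)"
    by (simp add: restrict_def)
  from P.indep_varD[OF this A B] show ?thesis
    by (simp add: vimage_def Int_def conj_commute)
qed

text \<open>The locale \<open>product_prob_space\<close> wants a probability measure at every index,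
  whereas a model only constrains the noise on \<open>I\<close>. Point masses fill the remaining
  indices, which the product over \<open>I\<close> does not see.\<close>

lemma measure_PiM_restrict_disjoint:
  assumes prob: "\<And>i. i \<in> I \<Longrightarrow> prob_space (M i)"
    and JL: "J \<subseteq> I" "L \<subseteq> I" "J \<inter> L = {}"
    and "A \<in> sets (Pi\<^sub>M J M)" "B \<in> sets (Pi\<^sub>M L M)"
  shows "measure (Pi\<^sub>M I M) {e \<in> space (Pi\<^sub>M I M). restrict e J \<in> A \<and> restrict e L \<in> B} =
    measure (Pi\<^sub>M I M) {e \<in> space (Pi\<^sub>M I M). restrict e J \<in> A} *
    measure (Pi\<^sub>M I M) {e \<in> space (Pi\<^sub>M I M). restrict e L \<in> B}"
proof -
  define N where "N i = (if i \<in> I then M i else return (count_space UNIV) undefined)" for i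
  have N: "prob_space (N i)" for i
    using prob by (auto simp: N_def intro!: prob_space_return)
  interpret product_prob_space N I
    by (rule product_prob_spaceI) (rule N)
  have eq: "Pi\<^sub>M K M = Pi\<^sub>M K N" if "K \<subseteq> I" for K
    using that by (intro PiM_cong) (auto simp: N_def)
  show ?thesis
    using measure_PiM_restrict_disjoint[of J L A B] assms by (simp add: eq[OF JL(1)] eq[OF JL(2)] eq[OF order_refl])
qed

section \<open>Solutions of the structural equations and their laws\<close>

locale semi_markovian =
  fixes M :: "('v, 'u, 'e, 'm) scm_scheme" and Y :: 'v
  assumes semi_markovian: "semi_markovian_scm M Y"
begin

lemma finite_obs: "finite (obs M)"
  and pa_subset: "i \<in> obs M \<Longrightarrow> pa M i \<subseteq> obs M"
  and exo_of_subset: "i \<in> obs M \<Longrightarrow> exo_of M i \<subseteq> exo M"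
  and acyclic_obs: "acyclic (observable_graph M)"
  and prob_space_noise: "u \<in> exo M \<Longrightarrow> prob_space (noise M u)"
  and eqn_measurable: "i \<in> obs M \<Longrightarrow> a \<in> assignments M (pa M i) \<Longrightarrow>
        eqn M i a \<in> Pi\<^sub>M (exo_of M i) (noise M) \<rightarrow>\<^sub>M count_space (vals M)"
  and Y_obs: "Y \<in> obs M"
  and dom_size_ge: "2 \<le> dom_size M"
  using semi_markovian by (auto simp: semi_markovian_scm_def)

lemma observable_graph_subset: "observable_graph M \<subseteq> obs M \<times> obs M"
  using pa_subset by (auto simp: observable_graph_def)

lemma wf_obs: "wf (observable_graph M)"
  using observable_graph_subset finite_obs acyclic_obs
  by (meson finite_SigmaI finite_acyclic_wf finite_subset)

lemma obs_induct [consumes 1, case_names step]: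
  assumes "i \<in> obs M"
    and "\<And>i. i \<in> obs M \<Longrightarrow> (\<And>j. j \<in> pa M i \<Longrightarrow> P j) \<Longrightarrow> P i"
  shows "P i"
  using wf_obs assms(1)
proof (induction i rule: wf_induct_rule)
  case (less i)
  then show ?case
    using pa_subset assms(2)[of i] by (auto simp: observable_graph_def)
qed

text \<open>Acyclicity makes the equations a well-founded recursion along the edges, which gives
  existence; uniqueness is induction over parents. This is what gives the definite description in
  \<open>solution\<close> its meaning.\<close>

lemma solution_ex1:
  "\<exists>!x. x \<in> extensional (obs M) \<and>
     (\<forall>i\<in>obs M. x i =
        (if i \<in> W then w i else eqn M i (restrict x (pa M i)) (restrict e (exo_of M i))))"
proof (rule ex_ex1I)
  define F where "F f i = (if i \<in> obs M then
      if i \<in> W then w i else eqn M i (restrict f (pa M i)) (restrict e (exo_of M i))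
      else undefined)" for f i
  have pa_cong: "restrict f (pa M i) = restrict g (pa M i)"
    if "\<forall>j. (j, i) \<in> observable_graph M \<longrightarrow> f j = g j" "i \<in> obs M" for f g :: "'v \<Rightarrow> nat" and i
    using that by (auto simp: restrict_def observable_graph_def fun_eq_iff)
  then have "F f i = F g i" if "\<forall>j. (j, i) \<in> observable_graph M \<longrightarrow> f j = g j" for f g i
    using pa_cong[OF that] by (simp add: F_def)
  then have "adm_wf (observable_graph M) F"
    unfolding adm_wf_def by blast
  from wfrec_fixpoint[OF wf_obs this]
  have *: "wfrec (observable_graph M) F i = F (wfrec (observable_graph M) F) i" for i
    by (rule fun_cong)
  show "\<exists>x. x \<in> extensional (obs M) \<and>
     (\<forall>i\<in>obs M. x i =
        (if i \<in> W then w i else eqn M i (restrict x (pa M i)) (restrict e (exo_of M i))))"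
  proof (intro exI conjI ballI)
    show "wfrec (observable_graph M) F \<in> extensional (obs M)"
      using * by (simp add: F_def extensional_def)
  qed (subst *, simp add: F_def)
next
  fix x y
  assume x: "x \<in> extensional (obs M) \<and>
     (\<forall>i\<in>obs M. x i =
        (if i \<in> W then w i else eqn M i (restrict x (pa M i)) (restrict e (exo_of M i))))"
    and y: "y \<in> extensional (obs M) \<and>
     (\<forall>i\<in>obs M. y i =
        (if i \<in> W then w i else eqn M i (restrict y (pa M i)) (restrict e (exo_of M i))))"
  have "x i = y i" if "i \<in> obs M" for i
    using that
  proof (induction rule: obs_induct)
    case (step i)
    then have "restrict x (pa M i) = restrict y (pa M i)"
      by (auto simp: restrict_def)
    then show ?case using x y step(1) by auto
  qed
  then show "x = y"
    using x y by (intro extensionalityI[of x "obs M"]) auto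
qed

lemma solution_extensional: "solution M W w e \<in> extensional (obs M)"
  and solution_eq: "i \<in> obs M \<Longrightarrow> solution M W w e i = (if i \<in> W then w i else
         eqn M i (restrict (solution M W w e) (pa M i)) (restrict e (exo_of M i)))"
  using theI'[OF solution_ex1[of W w e]] unfolding solution_def[symmetric] by blast+

lemma prob_space_exo: "prob_space (exo_measure M)"
  by (intro prob_space_PiM prob_space_noise)

text \<open>Range and measurability have to be proved together: \<open>eqn M i a\<close> is only
  controlled for parent values \<open>a\<close> in the domain. There are finitely many such
  \<open>a\<close>, so it is enough that the equation is measurable in the noise for each fixed
  \<open>a\<close>.\<close>

lemma solution_in_vals_measurable:
  assumes w: "w \<in> W \<rightarrow> vals M" and "i \<in> obs M"
  shows "(\<lambda>e. solution M W w e i) \<in> exo_measure M \<rightarrow>\<^sub>M count_space (vals M)"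
  using assms(2)
proof (induction rule: obs_induct)
  case (step i)
  show ?case
  proof (cases "i \<in> W")
    case True
    moreover have "w i \<in> vals M" using w True by blast
    ultimately show ?thesis
      using step(1) by (simp add: solution_eq)
  next
    case False
    have fin: "finite (pa M i)"
      using step(1) pa_subset finite_obs finite_subset by blast
    have IH: "(\<lambda>e. solution M W w e j) \<in> exo_measure M \<rightarrow>\<^sub>M count_space (vals M)" if "j \<in> pa M i" for j
      using step that by blast
    have m1: "(\<lambda>e. restrict (solution M W w e) (pa M i))
        \<in> exo_measure M \<rightarrow>\<^sub>M count_space (assignments M (pa M i))"
    proof (subst measurable_count_space_eq2)
      show "finite (assignments M (pa M i))"
        using fin by (intro finite_PiE) auto
      show "(\<lambda>e. restrict (solution M W w e) (pa M i)) \<in> space (exo_measure M) \<rightarrow> assignments M (pa M i) \<and>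
        (\<forall>a\<in>assignments M (pa M i). (\<lambda>e. restrict (solution M W w e) (pa M i)) -` {a} \<inter> space (exo_measure M)
          \<in> sets (exo_measure M))"
      proof (intro conjI ballI)
        show "(\<lambda>e. restrict (solution M W w e) (pa M i)) \<in> space (exo_measure M) \<rightarrow> assignments M (pa M i)"
          using measurable_space[OF IH] by (auto simp: PiE_iff)
      next
        fix a assume a: "a \<in> assignments M (pa M i)"
        have "(\<lambda>e. restrict (solution M W w e) (pa M i)) -` {a} \<inter> space (exo_measure M) =
            {e \<in> space (exo_measure M). \<forall>j\<in>pa M i. solution M W w e j = a j}"
          using a by (auto simp: fun_eq_iff PiE_iff extensional_def restrict_def)
        also have "\<dots> \<in> sets (exo_measure M)"
        proof (intro sets.sets_Collect_finite_All)
          fix j assume j: "j \<in> pa M i"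
          have "(\<lambda>e. solution M W w e j) -` {a j} \<inter> space (exo_measure M) \<in> sets (exo_measure M)"
            using a j by (intro measurable_sets[OF IH]) (auto simp: PiE_iff)
          then show "{e \<in> space (exo_measure M). solution M W w e j = a j} \<in> sets (exo_measure M)"
            by (simp add: vimage_def Int_def conj_commute)
        qed (use fin in auto)
        finally show "(\<lambda>e. restrict (solution M W w e) (pa M i)) -` {a} \<inter> space (exo_measure M)
          \<in> sets (exo_measure M)" .
      qed
    qed
    have m2: "(\<lambda>e. eqn M i a (restrict e (exo_of M i))) \<in> exo_measure M \<rightarrow>\<^sub>M count_space (vals M)"
      if "a \<in> assignments M (pa M i)" for a
      using measurable_restrict_subset[OF exo_of_subset[OF step(1)]] eqn_measurable[OF step(1) that]
      by (rule measurable_compose)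
    have m3: "countable (assignments M (pa M i))"
      using fin by (intro countable_finite finite_PiE) auto
    have "(\<lambda>e. eqn M i (restrict (solution M W w e) (pa M i)) (restrict e (exo_of M i)))
        \<in> exo_measure M \<rightarrow>\<^sub>M count_space (vals M)"
      using m2 m1 m3
      by (rule measurable_compose_countable'[where f = "\<lambda>a e. eqn M i a (restrict e (exo_of M i))"])
    with False step(1) show ?thesis by (simp add: solution_eq)
  qed
qed

lemma solution_in_vals:
  assumes "w \<in> W \<rightarrow> vals M" "i \<in> obs M" "e \<in> space (exo_measure M)"
  shows "solution M W w e i \<in> vals M"
  using measurable_space[OF solution_in_vals_measurable[OF assms(1,2)] assms(3)] by simp

text \<open>\<open>S\<close> can be arbitrary since the solutions take only finitely many values:
  the event is a finite union of events that fix every coordinate.\<close>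

lemma sets_solution:
  assumes w: "w \<in> W \<rightarrow> vals M"
  shows "{e \<in> space (exo_measure M). solution M W w e \<in> S} \<in> sets (exo_measure M)"
proof -
  have fin: "finite (assignments M (obs M))"
    using finite_obs by (intro finite_PiE) auto
  have in_ass: "solution M W w e \<in> assignments M (obs M)" if "e \<in> space (exo_measure M)" for e
    using solution_in_vals[OF w _ that] solution_extensional[of W w e] by (auto simp: PiE_iff)
  have "{e \<in> space (exo_measure M). solution M W w e \<in> S} =
     (\<Union>x\<in>assignments M (obs M) \<inter> S. {e \<in> space (exo_measure M). \<forall>i\<in>obs M. solution M W w e i = x i})"
    (is "_ = ?U")
  proof (intro set_eqI iffI)
    fix e assume "e \<in> {e \<in> space (exo_measure M). solution M W w e \<in> S}"
    then show "e \<in> ?U" using in_ass[of e] by auto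
  next
    fix e assume "e \<in> ?U"
    then obtain x where x: "x \<in> assignments M (obs M)" "x \<in> S" "e \<in> space (exo_measure M)"
      "\<forall>i\<in>obs M. solution M W w e i = x i" by auto
    then have "solution M W w e = x"
      using solution_extensional by (intro extensionalityI[of _ "obs M"]) (auto simp: PiE_iff)
    with x show "e \<in> {e \<in> space (exo_measure M). solution M W w e \<in> S}" by simp
  qed
  also have "\<dots> \<in> sets (exo_measure M)"
  proof (intro sets.finite_UN)
    fix x assume "x \<in> assignments M (obs M) \<inter> S"
    then have x: "x i \<in> vals M" if "i \<in> obs M" for i using that by (auto simp: PiE_iff)
    show "{e \<in> space (exo_measure M). \<forall>i\<in>obs M. solution M W w e i = x i} \<in> sets (exo_measure M)"
    proof (intro sets.sets_Collect_finite_All')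
      fix j assume j: "j \<in> obs M"
      have "(\<lambda>e. solution M W w e j) -` {x j} \<inter> space (exo_measure M) \<in> sets (exo_measure M)"
        using x j by (intro measurable_sets[OF solution_in_vals_measurable[OF w]]) auto
      then show "{e \<in> space (exo_measure M). solution M W w e j = x j} \<in> sets (exo_measure M)"
        by (simp add: vimage_def Int_def conj_commute)
    qed (use finite_obs Y_obs in auto)
  qed (use fin in auto)
  finally show ?thesis .
qed

text \<open>\<open>embed_pmf\<close> returns the given weights only if they sum to one. They do,
  because the finite set \<open>F\<close> of full assignments contains every solution and its
  preimages partition the noise space.\<close>

lemma prob_do_dist:
  assumes w: "w \<in> W \<rightarrow> vals M"
  shows "measure_pmf.prob (do_dist M W w) S =
    measure (exo_measure M) {e \<in> space (exo_measure M). solution M W w e \<in> S}"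
proof -
  interpret P: prob_space "exo_measure M" by (rule prob_space_exo)
  define F where "F = assignments M (obs M)"
  define f where "f x = P.prob {e \<in> space (exo_measure M). solution M W w e = x}" for x
  have fin: "finite F"
    unfolding F_def using finite_obs by (intro finite_PiE) auto
  have in_F: "solution M W w e \<in> F" if "e \<in> space (exo_measure M)" for e
    using solution_in_vals[OF w _ that] solution_extensional[of W w e] by (auto simp: PiE_iff F_def)
  have sum: "(\<Sum>x\<in>A. f x) = P.prob {e \<in> space (exo_measure M). solution M W w e \<in> A}"
    if "A \<subseteq> F" for A
  proof -
    have sets: "{e \<in> space (exo_measure M). solution M W w e = x} \<in> sets (exo_measure M)" for x
      using sets_solution[OF w, where S = "{x}"] by simp
    have "P.prob (\<Union>x\<in>A. {e \<in> space (exo_measure M). solution M W w e = x}) = (\<Sum>x\<in>A. f x)"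
      unfolding f_def using finite_subset[OF that fin] sets
      by (intro P.finite_measure_finite_Union) (auto simp: disjoint_family_on_def)
    moreover have "(\<Union>x\<in>A. {e \<in> space (exo_measure M). solution M W w e = x}) =
       {e \<in> space (exo_measure M). solution M W w e \<in> A}" by auto
    ultimately show ?thesis by simp
  qed
  have zero: "f x = 0" if "x \<notin> F" for x
  proof -
    have "{e \<in> space (exo_measure M). solution M W w e = x} = {}"
      using that in_F by auto
    then show ?thesis by (simp only: f_def measure_empty)
  qed
  have "(\<integral>\<^sup>+x. ennreal (f x) \<partial>count_space UNIV) = (\<integral>\<^sup>+x. ennreal (f x) \<partial>count_space F)"
    using zero by (intro nn_integral_count_space_eq) auto
  also have "\<dots> = ennreal (\<Sum>x\<in>F. f x)"
    using fin by (simp add: nn_integral_count_space_finite f_def)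
  also have "(\<Sum>x\<in>F. f x) = 1"
  proof -
    have "{e \<in> space (exo_measure M). solution M W w e \<in> F} = space (exo_measure M)"
      using in_F by auto
    then show ?thesis by (simp only: sum[OF order_refl] P.prob_space)
  qed
  finally have "(\<integral>\<^sup>+x. ennreal (f x) \<partial>count_space UNIV) = 1" by simp
  moreover have "0 \<le> f x" for x by (simp add: f_def)
  ultimately have "pmf (embed_pmf f) x = f x" for x
    by (intro pmf_embed_pmf)
  then have pmf: "pmf (do_dist M W w) x = f x" for x
    unfolding do_dist_def f_def by simp
  have "measure_pmf.prob (do_dist M W w) S = measure_pmf.prob (do_dist M W w) (S \<inter> F)"
    by (intro measure_prob_cong_0) (auto simp: pmf zero)
  also have "\<dots> = (\<Sum>x\<in>S \<inter> F. f x)"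
    using fin by (simp add: measure_measure_pmf_finite pmf)
  also have "\<dots> = P.prob {e \<in> space (exo_measure M). solution M W w e \<in> S \<inter> F}"
    by (rule sum) auto
  also have "{e \<in> space (exo_measure M). solution M W w e \<in> S \<inter> F} =
      {e \<in> space (exo_measure M). solution M W w e \<in> S}"
    using in_F by auto
  finally show ?thesis .
qed

lemma do_prob_eq:
  assumes "w \<in> W \<rightarrow> vals M"
  shows "do_prob M W w i x = measure (exo_measure M) {e \<in> space (exo_measure M). solution M W w e i = x}"
  by (simp add: do_prob_def prob_do_dist[OF assms])

text \<open>The equality holds for each noise value, hence in law. If \<open>i\<close> is not in
  \<open>W\<close>, the edges from its parents survive the removal, so no parent is \<open>a\<close>
  or a descendant of \<open>a\<close>, and the induction hypothesis applies to all of them.\<close>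

lemma solution_non_ancestor:
  assumes "i \<in> obs M" "i \<noteq> a" "(a, i) \<notin> (fst (remove_incoming (causal_graph M) W))\<^sup>+"
  shows "solution M (insert a W) (w(a := x)) e i = solution M W w e i"
  using assms
proof (induction rule: obs_induct)
  case (step i)
  let ?R = "fst (remove_incoming (causal_graph M) W)"
  show ?case
  proof (cases "i \<in> W")
    case False
    have "solution M (insert a W) (w(a := x)) e j = solution M W w e j" if j: "j \<in> pa M i" for j
    proof (rule step(2)[OF j])
      have ji: "(j, i) \<in> ?R"
        using False j step(1)
        by (auto simp: remove_incoming_def causal_graph_def observable_graph_def)
      then show "j \<noteq> a" using step(4) by auto
      show "(a, j) \<notin> ?R\<^sup>+" using ji step(4) by (meson trancl.trancl_into_trancl)
    qed
    then have "restrict (solution M (insert a W) (w(a := x)) e) (pa M i) =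
        restrict (solution M W w e) (pa M i)" by (auto simp: restrict_def)
    then show ?thesis using step(3) False by (simp del: fun_upd_apply add: solution_eq[OF step(1)])
  next
    case True
    then show ?thesis using step(1,3) by (simp add: solution_eq[OF step(1)])
  qed
qed

lemma do_prob_non_ancestor:
  assumes "w \<in> assignments M W" "x \<in> vals M"
    and "i \<in> obs M" "i \<noteq> a" "(a, i) \<notin> (fst (remove_incoming (causal_graph M) W))\<^sup>+"
  shows "do_prob M (insert a W) (w(a := x)) i y = do_prob M W w i y"
proof -
  have "do_prob M (insert a W) (w(a := x)) i y =
     measure (exo_measure M) {e \<in> space (exo_measure M). solution M (insert a W) (w(a := x)) e i = y}"
    using assms by (intro do_prob_eq) (auto simp: PiE_iff)
  also have "\<dots> = do_prob M W w i y"
    using assms by (subst do_prob_eq) (auto simp: PiE_iff solution_non_ancestor)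
  finally show ?thesis .
qed

text \<open>
  With all parents fixed, \<open>i\<close> and \<open>j\<close> are functions of disjoint blocks of independent noise,
  except for the direct influence of \<open>i\<close> on \<open>j\<close>.
\<close>

lemma do_prob_unconfounded:
  assumes ij: "i \<in> obs M" "j \<in> obs M" "i \<noteq> j" "j \<notin> pa M i"
    and W: "w \<in> assignments M W" "(pa M i \<union> pa M j) - {i} \<subseteq> W" "i \<notin> W" "j \<notin> W"
    and x: "x \<in> vals M" and y: "y \<in> vals M" and "\<not> confounded M i j"
    and pos: "do_prob M W w i x > 0"
  shows "do_prob M (insert i W) (w(i := x)) j y = do_cond_prob M W w i x j y"
proof -
  have wv: "w \<in> W \<rightarrow> vals M" using W(1) by (auto simp: PiE_iff)
  have wv': "w(i := x) \<in> insert i W \<rightarrow> vals M" using wv x by auto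
  \<comment> \<open>Without self-loops, subtracting \<open>i\<close> from the required parents loses
    no parent of \<open>i\<close>, so all of \<open>pa M i\<close> is fixed by
    \<open>w\<close>.\<close>
  have irr: "k \<notin> pa M k" if "k \<in> obs M" for k
  proof
    assume "k \<in> pa M k"
    then have "(k, k) \<in> (observable_graph M)\<^sup>+"
      using that by (intro r_into_trancl) (simp add: observable_graph_def)
    then show False using acyclic_obs by (simp add: acyclic_def)
  qed
  define ai where "ai = restrict w (pa M i)"
  define aj where "aj = restrict (w(i := x)) (pa M j)"
  have pai: "pa M i \<subseteq> W" using W irr[OF ij(1)] by auto
  have paj: "pa M j \<subseteq> insert i W" using W by auto
  have ai: "ai \<in> assignments M (pa M i)" using wv pai unfolding ai_def restrict_PiE_iff by blast
  have aj: "aj \<in> assignments M (pa M j)" using wv' paj unfolding aj_def restrict_PiE_iff by blast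
  let ?E = "exo_measure M"
  let ?fi = "\<lambda>e. eqn M i ai (restrict e (exo_of M i))"
  let ?fj = "\<lambda>e. eqn M j aj (restrict e (exo_of M j))"
  have sol_W: "solution M V v e k = v k" if "k \<in> V" "k \<in> obs M" for V v e k
    using that by (simp add: solution_eq)
  have res: "restrict (solution M V v e) (pa M k) = restrict v (pa M k)"
    if "pa M k \<subseteq> V" "k \<in> obs M" for V v e k
    using that pa_subset[OF that(2)] by (auto simp: restrict_def sol_W subset_iff)
  have si: "solution M W w e i = ?fi e" for e
    using ij W res[OF pai ij(1)] by (simp add: solution_eq[of i] ai_def)
  have sj': "solution M (insert i W) (w(i := x)) e j = ?fj e" for e
    using ij W res[OF paj ij(2)] by (simp add: solution_eq[of j] aj_def)
  \<comment> \<open>This is why conditioning agrees with intervening: on the event that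
    \<open>i\<close> takes the value \<open>x\<close>, the parents of \<open>j\<close> have the same
    values as under the intervention, so \<open>j\<close> is the same function of its noise in both
    models.\<close>
  have sj: "solution M W w e j = ?fj e" if "solution M W w e i = x" for e
  proof -
    have "solution M W w e k = (w(i := x)) k" if "k \<in> pa M j" for k
      using that paj pa_subset[OF ij(2)] \<open>solution M W w e i = x\<close> sol_W[of k W w e] by auto
    then have "restrict (solution M W w e) (pa M j) = aj"
      by (auto simp: aj_def restrict_def)
    then show ?thesis using ij W by (simp add: solution_eq[of j])
  qed
  define A where "A = eqn M i ai -` {x} \<inter> space (Pi\<^sub>M (exo_of M i) (noise M))"
  define B where "B = eqn M j aj -` {y} \<inter> space (Pi\<^sub>M (exo_of M j) (noise M))"
  have "A \<in> sets (Pi\<^sub>M (exo_of M i) (noise M))" "B \<in> sets (Pi\<^sub>M (exo_of M j) (noise M))"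
    unfolding A_def B_def using x y
    by (auto intro!: measurable_sets[OF eqn_measurable] ij ai aj)
  moreover have "exo_of M i \<inter> exo_of M j = {}"
    using assms(3,11) by (auto simp: confounded_def)
  ultimately have "measure ?E {e \<in> space ?E. restrict e (exo_of M i) \<in> A \<and> restrict e (exo_of M j) \<in> B} =
     measure ?E {e \<in> space ?E. restrict e (exo_of M i) \<in> A} *
     measure ?E {e \<in> space ?E. restrict e (exo_of M j) \<in> B}"
    using ij by (intro measure_PiM_restrict_disjoint prob_space_noise exo_of_subset) auto
  moreover have "restrict e (exo_of M k) \<in> space (Pi\<^sub>M (exo_of M k) (noise M))"
    if "e \<in> space ?E" "k \<in> obs M" for e k
    using that exo_of_subset[of k] by (auto simp: space_PiM PiE_iff)
  ultimately have indep: "measure ?E {e \<in> space ?E. ?fi e = x \<and> ?fj e = y} =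
     measure ?E {e \<in> space ?E. ?fi e = x} * measure ?E {e \<in> space ?E. ?fj e = y}"
    using ij by (simp add: A_def B_def cong: conj_cong)
  have "measure_pmf.prob (do_dist M W w) {v. v i = x \<and> v j = y} =
      measure ?E {e \<in> space ?E. ?fi e = x \<and> ?fj e = y}"
    using sj by (subst prob_do_dist[OF wv]) (auto simp: si cong: conj_cong)
  also have "\<dots> = do_prob M W w i x * do_prob M (insert i W) (w(i := x)) j y"
    unfolding do_prob_eq[OF wv] do_prob_eq[OF wv'] si sj' by (rule indep)
  finally show ?thesis
    using pos by (simp add: do_cond_prob_def)
qed

end

section \<open>Transitive reductions\<close>

text \<open>For a strict partial order this is the covering relation, that is, the edges of the
  Hasse diagram.\<close>

definition covers :: "('v \<times> 'v) set \<Rightarrow> ('v \<times> 'v) set" where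
  "covers H = {(a, b) \<in> H. \<nexists>c. (a, c) \<in> H \<and> (c, b) \<in> H}"

text \<open>A \<open>K\<close>-path with more than one edge would pass through a vertex strictly
  between the two ends, so a covering pair must itself be an edge of \<open>K\<close>.\<close>

lemma covers_subset_if_trancl_eq: "K\<^sup>+ = H \<Longrightarrow> covers H \<subseteq> K"
  unfolding covers_def by (auto elim: converse_tranclE)

text \<open>Induction on the number of vertices strictly between \<open>a\<close> and
  \<open>b\<close>. Splitting at such a \<open>c\<close> leaves two intervals that both omit
  \<open>c\<close>, hence are strictly smaller.\<close>

lemma trancl_covers:
  assumes "finite H" "trans H" "irrefl H"
  shows "(covers H)\<^sup>+ = H"
proof
  have "covers H \<subseteq> H" by (auto simp: covers_def)
  then show "(covers H)\<^sup>+ \<subseteq> H"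
    using trancl_mono_subset[of "covers H" H] trancl_id[OF assms(2)] by simp
next
  have "(a, b) \<in> (covers H)\<^sup>+" if "(a, b) \<in> H" for a b
    using that
  proof (induction "card {c. (a, c) \<in> H \<and> (c, b) \<in> H}" arbitrary: a b rule: less_induct)
    case less
    show ?case
    proof (cases "(a, b) \<in> covers H")
      case False
      then obtain c where c: "(a, c) \<in> H" "(c, b) \<in> H"
        using less.prems by (auto simp: covers_def)
      have fin: "finite {c. (a, c) \<in> H \<and> (c, b) \<in> H}"
        using finite_Range[OF assms(1)] by (rule finite_subset[rotated]) auto
      have "(c, c) \<notin> H" using assms(3) by (simp add: irrefl_def)
      then have "{d. (a, d) \<in> H \<and> (d, c) \<in> H} \<subset> {d. (a, d) \<in> H \<and> (d, b) \<in> H}"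
        "{d. (c, d) \<in> H \<and> (d, b) \<in> H} \<subset> {d. (a, d) \<in> H \<and> (d, b) \<in> H}"
        using c transD[OF assms(2)] by blast+
      then have "(a, c) \<in> (covers H)\<^sup>+" "(c, b) \<in> (covers H)\<^sup>+"
        using c by (auto intro!: less.hyps psubset_card_mono fin)
      then show ?thesis by (rule trancl_trans)
    qed auto
  qed
  then show "H \<subseteq> (covers H)\<^sup>+" by auto
qed

text \<open>\<open>ARG_MIN\<close> may return any minimiser. Every graph with closure
  \<open>H\<close> contains the covering relation, which has closure \<open>H\<close> too, so a
  minimiser has no room for further edges.\<close>

lemma transitive_reduction_eq_covers:
  assumes "finite H" "trans H" "irrefl H"
  shows "transitive_reduction H = covers H"
  unfolding transitive_reduction_def trancl_id[OF assms(2)]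
proof (rule arg_minI[where x = "covers H"])
  show "(covers H)\<^sup>+ = H" by (rule trancl_covers[OF assms])
next
  fix K assume K: "K\<^sup>+ = H"
  have "K \<subseteq> K\<^sup>+" by auto
  then have fin: "finite K" using K assms(1) finite_subset by metis
  then show "\<not> card K < card (covers H)"
    using card_mono[OF fin covers_subset_if_trancl_eq[OF K]] by simp
next
  fix K assume K: "K\<^sup>+ = H" and min: "\<forall>K'. K'\<^sup>+ = H \<longrightarrow> \<not> card K' < card K"
  have "K \<subseteq> K\<^sup>+" by auto
  then have fin: "finite K" using K assms(1) finite_subset by metis
  have "card K \<le> card (covers H)"
    using min trancl_covers[OF assms] by (simp add: not_less)
  then show "K = covers H"
    using card_seteq[OF fin covers_subset_if_trancl_eq[OF K]] by simp
qed

lemma transitive_reduction_trancl: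
  assumes "finite G" "acyclic G"
  shows "transitive_reduction (G\<^sup>+) = covers (G\<^sup>+)"
  using assms by (intro transitive_reduction_eq_covers) (auto simp: irrefl_def acyclic_def)

text \<open>A path into \<open>j\<close> must enter through \<open>i\<close>, its only parent, so a
  vertex strictly between \<open>i\<close> and \<open>j\<close> would close a cycle at
  \<open>i\<close>.\<close>

lemma mem_covers_trancl:
  assumes "acyclic G" "(i, j) \<in> G" "\<And>k. (k, j) \<in> G \<Longrightarrow> k = i"
  shows "(i, j) \<in> covers (G\<^sup>+)"
proof -
  have "False" if c: "(i, c) \<in> G\<^sup>+" "(c, j) \<in> G\<^sup>+" for c
  proof -
    obtain d where d: "(c, d) \<in> G\<^sup>*" "(d, j) \<in> G"
      using c(2) by (meson tranclD2)
    then have "(i, i) \<in> G\<^sup>+"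
      using c(1) assms(3)[OF d(2)] by (simp add: trancl_rtrancl_trancl)
    then show False using assms(1) by (simp add: acyclic_def)
  qed
  then show ?thesis using assms(2) by (auto simp: covers_def)
qed

text \<open>Once the edges into \<open>W\<close> are gone, a path that starts outside
  \<open>W\<close> can never enter it. The condition \<open>i \<noteq> j\<close> removes nothing, by
  acyclicity.\<close>

lemma trancl_induced_subgraph:
  assumes "acyclic G" "G \<subseteq> V \<times> V"
  shows "{(i, j). i \<in> V - W \<and> j \<in> V - W \<and> i \<noteq> j \<and> (i, j) \<in> {(i, j) \<in> G. j \<notin> W}\<^sup>+} =
    (G \<inter> (V - W) \<times> (V - W))\<^sup>+" (is "?L = ?S\<^sup>+")
proof
  have "(i, j) \<in> ?S\<^sup>+" if "(i, j) \<in> {(i, j) \<in> G. j \<notin> W}\<^sup>+" "i \<in> V - W" for i j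
    using that
  proof (induction rule: trancl_induct)
    case (base j)
    then show ?case using assms(2) by auto
  next
    case (step j k)
    then have "j \<in> V - W" using trancl_subset_Sigma[of ?S "V - W"] by blast
    with step have "(j, k) \<in> ?S" using assms(2) by auto
    with step show ?case by (meson trancl.trancl_into_trancl)
  qed
  then show "?L \<subseteq> ?S\<^sup>+" by auto
next
  have "acyclic ?S" using assms(1) by (rule acyclic_subset) auto
  moreover have "?S\<^sup>+ \<subseteq> {(i, j) \<in> G. j \<notin> W}\<^sup>+" by (rule trancl_mono_subset) auto
  moreover have "?S\<^sup>+ \<subseteq> (V - W) \<times> (V - W)" by (rule trancl_subset_Sigma) auto
  ultimately show "?S\<^sup>+ \<subseteq> ?L" by (auto simp: acyclic_def)
qed

section \<open>Runs of the algorithm\<close>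

text \<open>The graph as a function of the stored data. A run thereby splits into random draws of
  data sets and a deterministic computation on them, and all probability bounds concern the draws
  only.\<close>

definition closure_edges :: "'v set \<Rightarrow> nat \<Rightarrow> real \<Rightarrow> 'v data_set \<Rightarrow> ('v \<times> 'v) set" where
  "closure_edges V K \<epsilon> d =
     {(i, j). i \<in> V - target d \<and> j \<in> V - target d \<and> i \<noteq> j \<and>
        (\<exists>x\<in>{1..K}. \<exists>y\<in>{1..K}.
           \<bar>emp_prob (observed d) j y - emp_prob (intervened d i x) j y\<bar> > \<epsilon> / 2)}"

definition data_pmf ::
  "'v sampler \<Rightarrow> 'v set \<Rightarrow> nat \<Rightarrow> nat \<Rightarrow> nat \<Rightarrow> ('v set \<Rightarrow> 'v \<Rightarrow> nat) \<Rightarrow> 'v set \<Rightarrow> 'v data_set pmf" where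
  "data_pmf P V K A B c W =
     do {
       obs_data \<leftarrow> replicate_pmf B (P W (c W));
       int_data \<leftarrow> Pi_pmf ((V - W) \<times> {1..K}) []
         (\<lambda>(i, x). replicate_pmf A (P (insert i W) ((c W)(i := x))));
       return_pmf \<lparr>target = W, target_val = c W, observed = obs_data, intervened = curry int_data\<rparr>
     }"

lemma learn_transitive_closure_eq:
  "learn_transitive_closure P V K \<epsilon> A B c W =
     map_pmf (\<lambda>d. (closure_edges V K \<epsilon> d, d)) (data_pmf P V K A B c W)"
  by (simp add: learn_transitive_closure_def data_pmf_def map_bind_pmf closure_edges_def)

lemma map_observed_data_pmf:
  "map_pmf observed (data_pmf P V K A B c W) = replicate_pmf B (P W (c W))"
  by (simp add: data_pmf_def map_bind_pmf bind_return_pmf')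

lemma map_intervened_data_pmf:
  assumes "finite V" "i \<in> V - W" "x \<in> {1..K}"
  shows "map_pmf (\<lambda>d. intervened d i x) (data_pmf P V K A B c W) =
    replicate_pmf A (P (insert i W) ((c W)(i := x)))"
proof -
  have "map_pmf (\<lambda>d. intervened d i x) (data_pmf P V K A B c W) =
     map_pmf (\<lambda>f. f (i, x)) (Pi_pmf ((V - W) \<times> {1..K}) []
         (\<lambda>(i, x). replicate_pmf A (P (insert i W) ((c W)(i := x)))))"
    by (simp add: data_pmf_def map_bind_pmf) (simp add: map_pmf_def)
  also have "\<dots> = replicate_pmf A (P (insert i W) ((c W)(i := x)))"
    using assms by (subst Pi_pmf_component) auto
  finally show ?thesis .
qed

lemma target_data_pmf:
  "d \<in> set_pmf (data_pmf P V K A B c W) \<Longrightarrow> target d = W \<and> target_val d = c W"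
  by (auto simp: data_pmf_def)

lemma length_data_pmf:
  assumes "finite V" "d \<in> set_pmf (data_pmf P V K A B c W)"
  shows "length (observed d) = B"
    and "i \<in> V - W \<Longrightarrow> x \<in> {1..K} \<Longrightarrow> length (intervened d i x) = A"
proof -
  have "observed d \<in> set_pmf (map_pmf observed (data_pmf P V K A B c W))"
    using assms by auto
  then show "length (observed d) = B"
    by (simp add: map_observed_data_pmf set_replicate_pmf)
next
  assume ix: "i \<in> V - W" "x \<in> {1..K}"
  have "intervened d i x \<in> set_pmf (map_pmf (\<lambda>d. intervened d i x) (data_pmf P V K A B c W))"
    using assms by auto
  then show "length (intervened d i x) = A"
    by (simp add: map_intervened_data_pmf[OF assms(1) ix] set_replicate_pmf)
qed

section \<open>Iterations as independent draws of data sets\<close>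

definition draw_pmf ::
  "'v sampler \<Rightarrow> 'v set \<Rightarrow> nat \<Rightarrow> nat \<Rightarrow> nat \<Rightarrow> nat \<Rightarrow> ('v set \<Rightarrow> 'v \<Rightarrow> nat) \<Rightarrow> 'v data_set pmf" where
  "draw_pmf P V K A B dmax c = random_vertex_set V dmax \<bind> data_pmf P V K A B c"

text \<open>The assignments \<open>c k\<close> vary with the iteration, so the draws are independent
  but not identically distributed, and \<open>replicate_pmf\<close> does not fit. Bounds that are
  uniform over the iterations take the place of identical laws.\<close>

primrec draws_pmf ::
  "'v sampler \<Rightarrow> 'v set \<Rightarrow> nat \<Rightarrow> nat \<Rightarrow> nat \<Rightarrow> nat \<Rightarrow> (nat \<Rightarrow> 'v set \<Rightarrow> 'v \<Rightarrow> nat) \<Rightarrow> nat \<Rightarrow>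
     'v data_set list pmf" where
  "draws_pmf P V K A B dmax c 0 = return_pmf []"
| "draws_pmf P V K A B dmax c (Suc k) =
     do {ds \<leftarrow> draws_pmf P V K A B dmax c k; d \<leftarrow> draw_pmf P V K A B dmax (c k); return_pmf (ds @ [d])}"

definition learned_edges :: "'v set \<Rightarrow> nat \<Rightarrow> real \<Rightarrow> 'v data_set list \<Rightarrow> ('v \<times> 'v) set" where
  "learned_edges V K \<epsilon> ds = (\<Union>d\<in>set ds. transitive_reduction (closure_edges V K \<epsilon> d))"

lemma observable_graph_loop_eq:
  "observable_graph_loop P V K \<epsilon> A B c dmax k =
     map_pmf (\<lambda>ds. (learned_edges V K \<epsilon> ds, ds)) (draws_pmf P V K A B dmax c k)"
proof (induction k)
  case 0
  then show ?case by (simp add: learned_edges_def)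
next
  case (Suc k)
  then show ?case
    by (simp add: learn_transitive_closure_eq bind_map_pmf draw_pmf_def map_bind_pmf bind_assoc_pmf
        bind_return_pmf learned_edges_def Un_commute)
qed

lemma length_draws_pmf: "ds \<in> set_pmf (draws_pmf P V K A B dmax c k) \<Longrightarrow> length ds = k"
  by (induction k arbitrary: ds) auto

lemma map_nth_draws_pmf:
  assumes "j < k"
  shows "map_pmf (\<lambda>ds. ds ! j) (draws_pmf P V K A B dmax c k) = draw_pmf P V K A B dmax (c j)"
  using assms
proof (induction k)
  case (Suc k)
  let ?D = "draws_pmf P V K A B dmax c" and ?d = "draw_pmf P V K A B dmax"
  have "map_pmf (\<lambda>ds. ds ! j) (?D (Suc k)) =
      ?D k \<bind> (\<lambda>ds. ?d (c k) \<bind> (\<lambda>d. return_pmf (if j = k then d else ds ! j)))"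
    unfolding draws_pmf.simps map_bind_pmf using Suc.prems
    by (intro bind_pmf_cong refl) (auto simp: nth_append length_draws_pmf)
  also have "\<dots> = ?d (c j)"
    using Suc by (cases "j = k") (auto simp: bind_return_pmf' map_pmf_def[symmetric])
  finally show ?case .
qed simp

lemma nth_draws_pmf:
  assumes "ds \<in> set_pmf (draws_pmf P V K A B dmax c k)" "j < k"
  shows "ds ! j \<in> set_pmf (draw_pmf P V K A B dmax (c j))"
  using assms(1) unfolding map_nth_draws_pmf[OF assms(2), symmetric] by auto

lemma prob_draws_all_le:
  assumes "\<And>j. measure_pmf.prob (draw_pmf P V K A B dmax (c j)) {d. Q d} \<le> p"
  shows "measure_pmf.prob (draws_pmf P V K A B dmax c k) {ds. \<forall>d\<in>set ds. Q d} \<le> p ^ k"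
proof (induction k)
  case (Suc k)
  let ?D = "draws_pmf P V K A B dmax c" and ?d = "draw_pmf P V K A B dmax"
  have p: "0 \<le> p" using measure_nonneg assms by (rule order.trans)
  have "emeasure (?D (Suc k)) {ds. \<forall>d\<in>set ds. Q d} =
     (\<integral>\<^sup>+ds. indicator {ds. \<forall>d\<in>set ds. Q d} ds * emeasure (?d (c k)) {d. Q d} \<partial>?D k)"
    unfolding draws_pmf.simps emeasure_bind_pmf
  proof (intro nn_integral_cong)
    fix ds
    show "(\<integral>\<^sup>+d. emeasure (return_pmf (ds @ [d])) {ds. \<forall>d\<in>set ds. Q d} \<partial>?d (c k)) =
        indicator {ds. \<forall>d\<in>set ds. Q d} ds * emeasure (?d (c k)) {d. Q d}"
    proof (cases "\<forall>d\<in>set ds. Q d")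
      case True
      then show ?thesis by (auto simp: indicator_def simp flip: nn_integral_indicator)
    next
      case False
      then have "emeasure (return_pmf (ds @ [d])) {ds. \<forall>d\<in>set ds. Q d} = 0" for d
        by (auto simp: indicator_def)
      with False show ?thesis by simp
    qed
  qed
  also have "\<dots> = ennreal (measure_pmf.prob (?D k) {ds. \<forall>d\<in>set ds. Q d} * measure_pmf.prob (?d (c k)) {d. Q d})"
    by (simp add: nn_integral_multc measure_pmf.emeasure_eq_measure ennreal_mult)
  finally have "measure_pmf.prob (?D (Suc k)) {ds. \<forall>d\<in>set ds. Q d} =
     measure_pmf.prob (?D k) {ds. \<forall>d\<in>set ds. Q d} * measure_pmf.prob (?d (c k)) {d. Q d}"
    by (simp add: measure_pmf.emeasure_eq_measure)
  also have "\<dots> \<le> p ^ k * p"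
    using Suc assms p by (intro mult_mono) auto
  finally show ?case by (simp add: mult.commute)
qed simp

lemma prob_draws_ex_le:
  assumes "\<And>j. measure_pmf.prob (draw_pmf P V K A B dmax (c j)) {d. Q d} \<le> p"
  shows "measure_pmf.prob (draws_pmf P V K A B dmax c k) {ds. \<exists>d\<in>set ds. Q d} \<le> real k * p"
proof -
  let ?D = "draws_pmf P V K A B dmax c k"
  have "measure_pmf.prob ?D {ds. \<exists>d\<in>set ds. Q d} =
      measure_pmf.prob ?D ({ds. \<exists>d\<in>set ds. Q d} \<inter> set_pmf ?D)"
    by (simp add: measure_Int_set_pmf)
  also have "\<dots> \<le> measure_pmf.prob ?D (\<Union>j<k. {ds. Q (ds ! j)})"
    by (intro measure_pmf.finite_measure_mono) (auto simp: in_set_conv_nth length_draws_pmf intro!: bexI)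
  also have "\<dots> \<le> (\<Sum>j<k. measure_pmf.prob ?D {ds. Q (ds ! j)})"
    by (intro measure_pmf.finite_measure_subadditive_finite) auto
  also have "\<dots> \<le> (\<Sum>j<k. p)"
  proof (intro sum_mono)
    fix j assume "j \<in> {..<k}"
    then have "measure_pmf.prob ?D {ds. Q (ds ! j)} = measure_pmf.prob (draw_pmf P V K A B dmax (c j)) {d. Q d}"
      by (simp add: vimage_def flip: map_nth_draws_pmf[of j k P V K A B dmax c])
    with assms show "measure_pmf.prob ?D {ds. Q (ds ! j)} \<le> p" by simp
  qed
  finally show ?thesis by simp
qed

section \<open>The confounder phase: top-ups, failure bound and sample count\<close>

definition test_pairs :: "('v::linorder) set \<Rightarrow> ('v \<times> 'v) set \<Rightarrow> 'v data_set list \<Rightarrow> ('v \<times> 'v) set" where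
  "test_pairs V G ds =
     {p \<in> orient G ` {(i, j). i \<in> V \<and> j \<in> V \<and> i < j}. usable_indices G ds p \<noteq> {}}"

definition used_index ::
  "('v \<times> 'v \<Rightarrow> nat set \<Rightarrow> nat) \<Rightarrow> ('v \<times> 'v) set \<Rightarrow> 'v data_set list \<Rightarrow> 'v \<times> 'v \<Rightarrow> nat" where
  "used_index sel G ds p = sel p (usable_indices G ds p)"

definition new_data_pmf ::
  "'v sampler \<Rightarrow> nat \<Rightarrow> 'v data_set list \<Rightarrow> nat set \<Rightarrow> (nat \<Rightarrow> ('v \<Rightarrow> nat) list) pmf" where
  "new_data_pmf P N ds I =
     Pi_pmf I [] (\<lambda>k. replicate_pmf N (P (target (ds ! k)) (target_val (ds ! k))))"

definition confounder_edges ::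
  "('v::linorder) set \<Rightarrow> nat \<Rightarrow> real \<Rightarrow> ('v \<times> 'v \<Rightarrow> nat set \<Rightarrow> nat) \<Rightarrow> ('v \<times> 'v) set \<Rightarrow>
     'v data_set list \<Rightarrow> (nat \<Rightarrow> ('v \<Rightarrow> nat) list) \<Rightarrow> 'v set set" where
  "confounder_edges V K \<gamma> sel G ds new =
     {{i, j} |i j. (i, j) \<in> test_pairs V G ds \<and>
        confounder_test K \<gamma>
          (observed (ds ! used_index sel G ds (i, j)) @ new (used_index sel G ds (i, j)))
          (intervened (ds ! used_index sel G ds (i, j)) i) (i, j)}"

lemma learn_causal_graph_sized_eq:
  "learn_causal_graph_sized P V K \<epsilon> \<gamma> A B C c sel \<alpha> dmax =
     do {
       ds \<leftarrow> draws_pmf P V K A B dmax c (nat \<lfloor>8 * \<alpha> * real dmax * ln (real (card V))\<rfloor>);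
       let G = learned_edges V K \<epsilon> ds;
       let I = used_index sel G ds ` test_pairs V G ds;
       new \<leftarrow> new_data_pmf P (C - B) ds I;
       return_pmf ((G, confounder_edges V K \<gamma> sel G ds new),
         (\<Sum>d\<leftarrow>ds. num_samples V K d) + (\<Sum>k\<in>I. length (new k)))
     }"
  unfolding learn_causal_graph_sized_def learn_observable_graph_def observable_graph_loop_eq
    bind_map_pmf Let_def test_pairs_def used_index_def new_data_pmf_def confounder_edges_def
  by simp

lemma finite_test_pairs:
  assumes "finite V"
  shows "finite (test_pairs V G ds)"
proof (rule finite_subset)
  show "test_pairs V G ds \<subseteq> orient G ` (V \<times> V)"
    unfolding test_pairs_def by blast
qed (use assms in simp)

lemma used_index_lt:
  assumes "\<And>p I. I \<noteq> {} \<Longrightarrow> sel p I \<in> I" "p \<in> test_pairs V G ds"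
  shows "used_index sel G ds p < length ds" "usable G p (ds ! used_index sel G ds p)"
  using assms(1)[of "usable_indices G ds p" p] assms(2)
  by (auto simp: test_pairs_def used_index_def usable_indices_def)

text \<open>
  The data sets that are topped up depend on all the stored data, so the failures are summed over
  all stored data sets, each of which has the distribution of a single iteration.
\<close>

lemma prob_learn_causal_graph_sized_ge:
  fixes V :: "'v::linorder set" and \<alpha> :: real and dmax :: nat
    and Bad :: "'v data_set list set" and bad :: "'v data_set \<Rightarrow> ('v \<Rightarrow> nat) list \<Rightarrow> bool"
  defines "T \<equiv> nat \<lfloor>8 * \<alpha> * real dmax * ln (real (card V))\<rfloor>"
  assumes "finite V" and sel: "\<And>p I. I \<noteq> {} \<Longrightarrow> sel p I \<in> I"
    and stage1: "measure_pmf.prob (draws_pmf P V K A B dmax c T) Bad \<le> b1"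
    and stage2: "\<And>k. (\<integral>\<^sup>+d. emeasure (replicate_pmf (C - B) (P (target d) (target_val d)))
        {new. bad d new} \<partial>draw_pmf P V K A B dmax (c k)) \<le> ennreal b2"
    and "0 \<le> b2"
    and correct: "\<And>ds new. ds \<in> set_pmf (draws_pmf P V K A B dmax c T) \<Longrightarrow> ds \<notin> Bad \<Longrightarrow>
      (\<And>p. p \<in> test_pairs V (learned_edges V K \<epsilon> ds) ds \<Longrightarrow>
         \<not> bad (ds ! used_index sel (learned_edges V K \<epsilon> ds) ds p)
            (new (used_index sel (learned_edges V K \<epsilon> ds) ds p))) \<Longrightarrow>
      (learned_edges V K \<epsilon> ds, confounder_edges V K \<gamma> sel (learned_edges V K \<epsilon> ds) ds new) = G"
  shows "measure_pmf.prob (learn_causal_graph_sized P V K \<epsilon> \<gamma> A B C c sel \<alpha> dmax) {(G', s). G' = G}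
    \<ge> 1 - b1 - real T * b2"
proof -
  let ?R = "learn_causal_graph_sized P V K \<epsilon> \<gamma> A B C c sel \<alpha> dmax"
  let ?D = "draws_pmf P V K A B dmax c T"
  let ?F = "{(G', s). G' \<noteq> G} :: ('v mixed_graph \<times> nat) set"
  let ?fail = "\<lambda>d. emeasure (replicate_pmf (C - B) (P (target d) (target_val d))) {new. bad d new}"
  define I where "I ds = used_index sel (learned_edges V K \<epsilon> ds) ds ` test_pairs V (learned_edges V K \<epsilon> ds) ds"
    for ds
  define out where "out ds new = ((learned_edges V K \<epsilon> ds, confounder_edges V K \<gamma> sel (learned_edges V K \<epsilon> ds) ds new),
         (\<Sum>d\<leftarrow>ds. num_samples V K d) + (\<Sum>k\<in>I ds. length (new k)))" for ds new
  have R: "?R = ?D \<bind> (\<lambda>ds. map_pmf (out ds) (new_data_pmf P (C - B) ds (I ds)))"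
    by (simp add: learn_causal_graph_sized_eq I_def out_def T_def Let_def map_pmf_def)
  have b1: "0 \<le> b1" using measure_nonneg stage1 by (rule order.trans)
  \<comment> \<open>For fixed stored data: either they are bad, or the output can be wrong only if a
    top-up at some used index fails.\<close>
  have step: "emeasure (map_pmf (out ds) (new_data_pmf P (C - B) ds (I ds))) ?F \<le>
      indicator Bad ds + (\<Sum>k<T. ?fail (ds ! k))" if ds: "ds \<in> set_pmf ?D" for ds
  proof (cases "ds \<in> Bad")
    case True
    have "emeasure (map_pmf (out ds) (new_data_pmf P (C - B) ds (I ds))) ?F \<le> 1"
      by (rule measure_pmf.emeasure_le_1)
    also have "1 \<le> indicator Bad ds + (\<Sum>k<T. ?fail (ds ! k))"
      using True by simp
    finally show ?thesis .
  next
    case False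
    have fin: "finite (I ds)" by (simp add: I_def finite_test_pairs \<open>finite V\<close>)
    have I: "I ds \<subseteq> {..<T}"
      using used_index_lt[OF sel] length_draws_pmf[OF ds] by (auto simp: I_def)
    let ?N = "new_data_pmf P (C - B) ds (I ds)"
    have good: "out ds new \<notin> ?F" if "\<And>k. k \<in> I ds \<Longrightarrow> \<not> bad (ds ! k) (new k)" for new
      using correct[OF ds False, of new] that by (auto simp: out_def I_def)
    have "out ds -` ?F \<subseteq> (\<Union>k\<in>I ds. {new. bad (ds ! k) (new k)})"
    proof
      fix new assume "new \<in> out ds -` ?F"
      then have "out ds new \<in> ?F" by (rule vimageD)
      with good[of new] have "\<exists>k\<in>I ds. bad (ds ! k) (new k)" by metis
      then show "new \<in> (\<Union>k\<in>I ds. {new. bad (ds ! k) (new k)})" by simp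
    qed
    then have "emeasure (map_pmf (out ds) ?N) ?F \<le> emeasure ?N (\<Union>k\<in>I ds. {new. bad (ds ! k) (new k)})"
      by (simp only: emeasure_map_pmf) (intro emeasure_mono, auto)
    also have "\<dots> \<le> (\<Sum>k\<in>I ds. emeasure ?N {new. bad (ds ! k) (new k)})"
      using fin by (intro emeasure_subadditive_finite) auto
    also have "\<dots> = (\<Sum>k\<in>I ds. ?fail (ds ! k))"
    proof (intro sum.cong refl)
      fix k assume k: "k \<in> I ds"
      have "emeasure ?N {new. bad (ds ! k) (new k)} = emeasure (map_pmf (\<lambda>f. f k) ?N) {new. bad (ds ! k) new}"
        by (simp add: vimage_def)
      also have "map_pmf (\<lambda>f. f k) ?N = replicate_pmf (C - B) (P (target (ds ! k)) (target_val (ds ! k)))"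
        unfolding new_data_pmf_def by (subst Pi_pmf_component[OF fin]) (simp add: k)
      finally show "emeasure ?N {new. bad (ds ! k) (new k)} = ?fail (ds ! k)" .
    qed
    also have "\<dots> \<le> (\<Sum>k<T. ?fail (ds ! k))"
      using I by (intro sum_mono2) auto
    finally show ?thesis using False by simp
  qed
  have "emeasure ?R ?F = (\<integral>\<^sup>+ds. emeasure (map_pmf (out ds) (new_data_pmf P (C - B) ds (I ds))) ?F \<partial>?D)"
    by (simp only: R emeasure_bind_pmf)
  also have "\<dots> \<le> (\<integral>\<^sup>+ds. indicator Bad ds + (\<Sum>k<T. ?fail (ds ! k)) \<partial>?D)"
    by (intro nn_integral_mono_AE AE_pmfI step)
  also have "\<dots> = emeasure ?D Bad + (\<Sum>k<T. \<integral>\<^sup>+ds. ?fail (ds ! k) \<partial>?D)"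
    by (simp add: nn_integral_add nn_integral_sum)
  also have "\<dots> \<le> ennreal b1 + (\<Sum>k<T. ennreal b2)"
  proof (intro add_mono sum_mono)
    show "emeasure ?D Bad \<le> ennreal b1"
      using stage1 by (simp add: measure_pmf.emeasure_eq_measure ennreal_leI)
  next
    \<comment> \<open>After the set of used indices has been enlarged to all of them, the
      \<open>k\<close>-th term depends on the run only through \<open>ds ! k\<close>, so its
      marginal law suffices.\<close>
    fix k assume "k \<in> {..<T}"
    then have k: "k < T" by simp
    have "(\<integral>\<^sup>+ds. ?fail (ds ! k) \<partial>?D) = (\<integral>\<^sup>+d. ?fail d \<partial>map_pmf (\<lambda>ds. ds ! k) ?D)"
      by simp
    also have "\<dots> = (\<integral>\<^sup>+d. ?fail d \<partial>draw_pmf P V K A B dmax (c k))"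
      by (simp only: map_nth_draws_pmf[OF k])
    finally show "(\<integral>\<^sup>+ds. ?fail (ds ! k) \<partial>?D) \<le> ennreal b2"
      using stage2[of k] by simp
  qed
  also have "\<dots> = ennreal (b1 + real T * b2)"
    using b1 \<open>0 \<le> b2\<close> by (simp add: ennreal_mult ennreal_of_nat_eq_real_of_nat)
  finally have "ennreal (measure_pmf.prob ?R ?F) \<le> ennreal (b1 + real T * b2)"
    by (simp only: measure_pmf.emeasure_eq_measure)
  then have "measure_pmf.prob ?R ?F \<le> b1 + real T * b2"
    using b1 \<open>0 \<le> b2\<close> by (subst (asm) ennreal_le_iff) simp_all
  moreover have "{(G', s). G' = G} = - ?F" by auto
  then have "measure_pmf.prob ?R {(G', s). G' = G} = 1 - measure_pmf.prob ?R ?F"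
    using measure_pmf.prob_compl[of ?F ?R] by (simp add: Compl_eq_Diff_UNIV)
  ultimately show ?thesis by simp
qed

text \<open>Top-ups are indexed by data sets and not by pairs, so there are at most as many as
  iterations. Each brings the observed part to \<open>B + (C - B)\<close> samples, which is
  \<open>max B C\<close> under truncated subtraction.\<close>

lemma learn_causal_graph_sized_samples:
  fixes V :: "'v::linorder set"
  assumes fin: "finite V" and sel: "\<And>p I. I \<noteq> {} \<Longrightarrow> sel p I \<in> I"
    and mem: "(G, s) \<in> set_pmf (learn_causal_graph_sized P V K \<epsilon> \<gamma> A B C c sel \<alpha> dmax)"
  shows "s \<le> nat \<lfloor>8 * \<alpha> * real dmax * ln (real (card V))\<rfloor> * (K * A * card V + max B C)"
proof -
  define T where "T = nat \<lfloor>8 * \<alpha> * real dmax * ln (real (card V))\<rfloor>"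
  define J where "J ds = used_index sel (learned_edges V K \<epsilon> ds) ds ` test_pairs V (learned_edges V K \<epsilon> ds) ds"
    for ds
  obtain ds new where ds: "ds \<in> set_pmf (draws_pmf P V K A B dmax c T)"
    and new: "new \<in> set_pmf (new_data_pmf P (C - B) ds (J ds))"
    and s: "s = (\<Sum>d\<leftarrow>ds. num_samples V K d) + (\<Sum>k\<in>J ds. length (new k))"
    using mem by (auto simp: learn_causal_graph_sized_eq Let_def T_def J_def)
  have finI: "finite (J ds)" by (simp add: J_def finite_test_pairs fin)
  have I: "J ds \<subseteq> {..<T}"
    using used_index_lt[OF sel] length_draws_pmf[OF ds] by (auto simp: J_def)
  have "num_samples V K d \<le> B + K * A * card V" if d: "d \<in> set ds" for d
  proof -
    obtain j where "j < T" "d = ds ! j"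
      using d length_draws_pmf[OF ds] by (auto simp: in_set_conv_nth)
    then obtain W where W: "d \<in> set_pmf (data_pmf P V K A B (c j) W)"
      using nth_draws_pmf[OF ds] by (auto simp: draw_pmf_def)
    have "num_samples V K d = B + (\<Sum>i\<in>V - W. \<Sum>x=1..K. A)"
      unfolding num_samples_def length_data_pmf(1)[OF fin W] target_data_pmf[OF W, THEN conjunct1]
      by (intro arg_cong2[where f = "(+)"] refl sum.cong length_data_pmf(2)[OF fin W])
    also have "\<dots> = B + K * A * card (V - W)" by simp
    also have "\<dots> \<le> B + K * A * card V"
      using fin by (intro add_mono mult_left_mono card_mono) auto
    finally show ?thesis .
  qed
  then have "(\<Sum>d\<leftarrow>ds. num_samples V K d) \<le> (\<Sum>d\<leftarrow>ds. B + K * A * card V)"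
    by (intro sum_list_mono)
  also have "\<dots> = T * (B + K * A * card V)"
    using length_draws_pmf[OF ds] by (simp add: sum_list_triv)
  finally have 1: "(\<Sum>d\<leftarrow>ds. num_samples V K d) \<le> T * (B + K * A * card V)" .
  have "length (new k) = C - B" if "k \<in> J ds" for k
    using new that unfolding new_data_pmf_def set_Pi_pmf[OF finI]
    by (auto simp: PiE_dflt_def set_replicate_pmf)
  then have "(\<Sum>k\<in>J ds. length (new k)) = card (J ds) * (C - B)" by simp
  also have "\<dots> \<le> T * (C - B)"
    using card_mono[OF _ I] by (intro mult_right_mono) auto
  finally have "s \<le> T * (B + K * A * card V) + T * (C - B)" using 1 s by simp
  also have "\<dots> = T * (K * A * card V + max B C)"
  proof -
    have "B + K * A * card V + (C - B) = K * A * card V + max B C" by auto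
    then show ?thesis by (simp only: distrib_left[symmetric])
  qed
  finally show ?thesis unfolding T_def .
qed

section \<open>Union bounds and the random intervention targets\<close>

lemma prob_bind_pmf_le:
  assumes "\<And>x. x \<in> set_pmf p \<Longrightarrow> measure_pmf.prob (f x) S \<le> b" "0 \<le> b"
  shows "measure_pmf.prob (p \<bind> f) S \<le> b"
proof -
  have "emeasure (measure_pmf (p \<bind> f)) S = (\<integral>\<^sup>+x. emeasure (f x) S \<partial>p)"
    by (rule emeasure_bind_pmf)
  also have "\<dots> \<le> (\<integral>\<^sup>+x. ennreal b \<partial>p)"
    using assms by (intro nn_integral_mono_AE AE_pmfI)
      (auto simp: measure_pmf.emeasure_eq_measure intro!: ennreal_leI)
  finally show ?thesis
    using assms(2) by (simp add: measure_pmf.emeasure_eq_measure)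
qed

lemma prob_Bex_le:
  assumes "finite I" "\<And>i. i \<in> I \<Longrightarrow> measure_pmf.prob p {x. Q i x} \<le> b"
  shows "measure_pmf.prob p {x. \<exists>i\<in>I. Q i x} \<le> real (card I) * b"
proof -
  have "{x. \<exists>i\<in>I. Q i x} = (\<Union>i\<in>I. {x. Q i x})" by auto
  then have "measure_pmf.prob p {x. \<exists>i\<in>I. Q i x} \<le> (\<Sum>i\<in>I. measure_pmf.prob p {x. Q i x})"
    by (simp only:) (intro measure_pmf.finite_measure_subadditive_finite assms, auto)
  also have "\<dots> \<le> (\<Sum>i\<in>I. b)" by (intro sum_mono assms)
  finally show ?thesis by simp
qed

lemma map_target_draw_pmf: "map_pmf target (draw_pmf P V K A B dmax c) = random_vertex_set V dmax"
proof -
  have "map_pmf target (data_pmf P V K A B c W) = return_pmf W" for W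
    by (simp add: data_pmf_def map_bind_pmf)
  then show ?thesis by (simp add: draw_pmf_def map_bind_pmf bind_return_pmf')
qed

lemma set_random_vertex_set: "W \<in> set_pmf (random_vertex_set V dmax) \<Longrightarrow> W \<subseteq> V"
  by (auto simp: random_vertex_set_def)

lemma draw_pmfE:
  assumes "d \<in> set_pmf (draw_pmf P V K A B dmax c)"
  obtains "target d \<subseteq> V" "target_val d = c (target d)"
  using assms target_data_pmf set_random_vertex_set by (fastforce simp: draw_pmf_def)

lemma prob_random_vertex_set_ge:
  assumes "finite V" "1 \<le> dmax" "S \<subseteq> V" "card S \<le> 2 * dmax" "i \<in> V - S" "j \<in> V - S" "i \<noteq> j"
  shows "measure_pmf.prob (random_vertex_set V dmax) {W. S \<subseteq> W \<and> i \<notin> W \<and> j \<notin> W}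
    \<ge> 1 / (16 * (real dmax)\<^sup>2)"
proof -
  define r where "r = 1 - 1 / (2 * real dmax)"
  have r: "0 \<le> r" "r \<le> 1" using assms(2) by (auto simp: r_def field_simps)
  \<comment> \<open>The event restricts each coordinate separately; vertices outside
    \<open>S\<close> other than \<open>i\<close> and \<open>j\<close> are free and contribute a
    factor 1.\<close>
  define B where "B v = (if v \<in> S then {True} else if v \<in> {i, j} then {False} else UNIV)" for v
  let ?p = "Pi_pmf V False (\<lambda>_. bernoulli_pmf r)"
  have "measure_pmf.prob (random_vertex_set V dmax) {W. S \<subseteq> W \<and> i \<notin> W \<and> j \<notin> W} =
     measure_pmf.prob ?p ((\<lambda>b. {v \<in> V. b v}) -` {W. S \<subseteq> W \<and> i \<notin> W \<and> j \<notin> W})"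
    by (simp add: random_vertex_set_def r_def)
  also have "(\<lambda>b. {v \<in> V. b v}) -` {W. S \<subseteq> W \<and> i \<notin> W \<and> j \<notin> W} = Pi V B"
    using assms by (auto simp: B_def Pi_iff split: if_splits)
  also have "measure_pmf.prob ?p (Pi V B) = (\<Prod>v\<in>V. measure_pmf.prob (bernoulli_pmf r) (B v))"
    using assms by (intro measure_Pi_pmf_Pi) auto
  also have "\<dots> = (\<Prod>v\<in>S \<union> {i, j}. measure_pmf.prob (bernoulli_pmf r) (B v))"
    using assms by (intro prod.mono_neutral_right) (auto simp: B_def)
  also have "\<dots> = (\<Prod>v\<in>S. measure_pmf.prob (bernoulli_pmf r) (B v)) *
      (\<Prod>v\<in>{i, j}. measure_pmf.prob (bernoulli_pmf r) (B v))"
    using assms finite_subset[OF assms(3,1)] by (intro prod.union_disjoint) auto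
  also have "(\<Prod>v\<in>S. measure_pmf.prob (bernoulli_pmf r) (B v)) = r ^ card S"
    using r by (simp add: B_def measure_pmf_single)
  also have "(\<Prod>v\<in>{i, j}. measure_pmf.prob (bernoulli_pmf r) (B v)) = (1 - r) ^ 2"
    using assms r by (simp add: B_def measure_pmf_single power2_eq_square)
  finally have eq: "measure_pmf.prob (random_vertex_set V dmax) {W. S \<subseteq> W \<and> i \<notin> W \<and> j \<notin> W} =
      r ^ card S * (1 - r)\<^sup>2" .
  \<comment> \<open>Bernoulli's inequality at exponent \<open>dmax\<close> gives 1/2, whereas at
    \<open>2 * dmax\<close> it would give only 0. Squaring yields 1/4, and
    \<open>(1 - r)\<^sup>2\<close> is \<open>1 / (4 * (real dmax)\<^sup>2)\<close>, whence the
    16.\<close>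
  have "1 + real dmax * (- 1 / (2 * real dmax)) \<le> (1 + (- 1 / (2 * real dmax))) ^ dmax"
    using assms(2) by (intro Bernoulli_inequality) (auto simp: field_simps)
  then have "1 / 2 \<le> r ^ dmax"
    using assms(2) by (simp add: r_def)
  then have "(1 / 2)\<^sup>2 \<le> (r ^ dmax)\<^sup>2" by (intro power_mono) auto
  also have "\<dots> = r ^ (2 * dmax)" by (simp add: power_even_eq)
  also have "\<dots> \<le> r ^ card S" using r assms(4) by (intro power_decreasing) auto
  finally have "(1 / 2)\<^sup>2 * (1 - r)\<^sup>2 \<le> r ^ card S * (1 - r)\<^sup>2"
    by (intro mult_right_mono) auto
  then show ?thesis unfolding eq by (simp add: r_def power2_eq_square)
qed

section \<open>Correctness of the learned graph\<close>

locale causal_learning = semi_markovian M Y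
  for M :: "('v::linorder, 'u, 'e) scm" and Y :: 'v +
  fixes \<epsilon> \<gamma> \<eta> :: real and dmax :: nat
  assumes eps: "0 < \<epsilon>" and ancestrality: "ancestrality_gap M \<epsilon>"
    and gam: "0 < \<gamma>" and confounder: "confounder_gap M \<gamma>"
    and eta: "0 < \<eta>" and positivity: "positivity M \<eta>"
    and dmax: "1 \<le> dmax" and degree: "v \<in> obs M \<Longrightarrow> vertex_degree (observable_graph M) v \<le> dmax"
begin

abbreviation "V \<equiv> obs M"
abbreviation "K \<equiv> dom_size M"
abbreviation "n \<equiv> card (obs M)"
abbreviation "G \<equiv> observable_graph M"

definition valid :: "'v data_set \<Rightarrow> bool" where
  "valid d \<longleftrightarrow> target d \<subseteq> V \<and> target_val d \<in> assignments M (target d)"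

text \<open>The interventional samples serve both tests and must meet the smaller tolerance, which
  is the origin of the maximum in \<open>size_A\<close>. The observed samples matter here for the
  closure test only; their use for conditional frequencies is judged after the top-up.\<close>

definition accurate :: "'v data_set \<Rightarrow> bool" where
  "accurate d \<longleftrightarrow>
     (\<forall>(j, y)\<in>V \<times> {1..K}.
        \<bar>emp_prob (observed d) j y - do_prob M (target d) (target_val d) j y\<bar> \<le> \<epsilon> / 4) \<and>
     (\<forall>(i, x, j, y)\<in>(V - target d) \<times> {1..K} \<times> V \<times> {1..K}.
        \<bar>emp_prob (intervened d i x) j y
          - do_prob M (insert i (target d)) ((target_val d)(i := x)) j y\<bar> \<le> min \<epsilon> \<gamma> / 4)"

text \<open>The clauses about the count tie the empirical test to the true model: the test never
  considers an \<open>x\<close> with undefined conditional probability, and never misses an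
  \<open>x\<close> that exhibits the gap.\<close>

definition cond_deviates ::
  "'v set \<Rightarrow> ('v \<Rightarrow> nat) \<Rightarrow> ('v \<Rightarrow> nat) list \<Rightarrow> 'v \<Rightarrow> nat \<Rightarrow> 'v \<Rightarrow> nat \<Rightarrow> bool" where
  "cond_deviates W w xs i x j y \<longleftrightarrow>
     (if do_prob M W w i x = 0 then sample_count xs (\<lambda>v. v i = x) > 0
      else sample_count xs (\<lambda>v. v i = x) = 0 \<or>
        \<gamma> / 4 < \<bar>emp_cond_prob xs i x j y - do_cond_prob M W w i x j y\<bar>)"

text \<open>The quantifier runs over all pairs of vertices, so that the event does not mention which
  pairs will use the data set.\<close>

definition cond_inaccurate :: "'v set \<Rightarrow> ('v \<Rightarrow> nat) \<Rightarrow> ('v \<Rightarrow> nat) list \<Rightarrow> bool" where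
  "cond_inaccurate W w xs \<longleftrightarrow>
     (\<exists>(i, x, j, y)\<in>V \<times> {1..K} \<times> V \<times> {1..K}. cond_deviates W w xs i x j y)"

section \<open>Deterministic correctness when all estimates are accurate\<close>

lemma finite_G: "finite G"
  using finite_obs by (intro finite_subset[OF observable_graph_subset]) auto

lemma fst_remove_incoming: "fst (remove_incoming (causal_graph M) W) = {(i, j) \<in> G. j \<notin> W}"
  by (simp add: remove_incoming_def causal_graph_def)

lemma closure_edges_accurate:
  assumes "valid d" "accurate d"
  shows "closure_edges V K \<epsilon> d = (G \<inter> (V - target d) \<times> (V - target d))\<^sup>+"
proof -
  define W w where "W = target d" and "w = target_val d"
  let ?R = "{(i, j) \<in> G. j \<notin> W}"
  have W: "W \<subseteq> V" "w \<in> assignments M W"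
    using assms(1) by (auto simp: valid_def W_def w_def)
  have "(\<exists>x\<in>{1..K}. \<exists>y\<in>{1..K}.
           \<bar>emp_prob (observed d) j y - emp_prob (intervened d i x) j y\<bar> > \<epsilon> / 2) \<longleftrightarrow> (i, j) \<in> ?R\<^sup>+"
    (is "?test \<longleftrightarrow> _") if ij: "i \<in> V - W" "j \<in> V - W" "i \<noteq> j" for i j
  proof -
    have acc: "\<bar>emp_prob (observed d) j y - do_prob M W w j y\<bar> \<le> \<epsilon> / 4"
      "\<bar>emp_prob (intervened d i x) j y - do_prob M (insert i W) (w(i := x)) j y\<bar> \<le> \<epsilon> / 4"
      if "x \<in> {1..K}" "y \<in> {1..K}" for x y
      using assms(2) ij that unfolding accurate_def W_def w_def by fastforce+
    show ?thesis
    proof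
      assume ?test
      then obtain x y where xy: "x \<in> {1..K}" "y \<in> {1..K}"
        "\<bar>emp_prob (observed d) j y - emp_prob (intervened d i x) j y\<bar> > \<epsilon> / 2" by blast
      show "(i, j) \<in> ?R\<^sup>+"
      proof (rule ccontr)
        assume "(i, j) \<notin> ?R\<^sup>+"
        then have "do_prob M (insert i W) (w(i := x)) j y = do_prob M W w j y"
          using W ij xy(1) by (intro do_prob_non_ancestor) (auto simp: fst_remove_incoming)
        with acc[OF xy(1,2)] xy(3) show False by linarith
      qed
    next
      assume "(i, j) \<in> ?R\<^sup>+"
      then obtain x y where xy: "x \<in> {1..K}" "y \<in> {1..K}"
        "\<bar>do_prob M W w j y - do_prob M (insert i W) (w(i := x)) j y\<bar> > \<epsilon>"
        using ancestrality[unfolded ancestrality_gap_def fst_remove_incoming,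
            THEN spec[of _ W], THEN spec[of _ i], THEN spec[of _ j],
            THEN mp, OF W(1), THEN mp, OF ij(1), THEN mp, OF ij(2), THEN mp, OF ij(3)] W(2)
        by metis
      have "\<bar>emp_prob (observed d) j y - emp_prob (intervened d i x) j y\<bar> > \<epsilon> / 2"
        using acc[OF xy(1,2)] xy(3) by linarith
      with xy show ?test by blast
    qed
  qed
  then have "closure_edges V K \<epsilon> d =
      {(i, j). i \<in> V - W \<and> j \<in> V - W \<and> i \<noteq> j \<and> (i, j) \<in> ?R\<^sup>+}"
    unfolding closure_edges_def W_def by blast
  also have "\<dots> = (G \<inter> (V - W) \<times> (V - W))\<^sup>+"
    by (rule trancl_induced_subgraph[OF acyclic_obs observable_graph_subset])
  finally show ?thesis by (simp add: W_def)
qed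

text \<open>The orientations that the confounder gap admits; incomparable pairs occur in both. All
  true edges are among them, so one coverage event serves the directed and the bidirected
  edges.\<close>

definition ordered_pairs :: "('v \<times> 'v) set" where
  "ordered_pairs = {(i, j). i \<in> V \<and> j \<in> V \<and> i \<noteq> j \<and> (j, i) \<notin> G\<^sup>+}"

lemma not_both_ancestors: "(i, j) \<in> G\<^sup>+ \<Longrightarrow> (j, i) \<notin> G\<^sup>+"
  using acyclic_obs by (meson acyclic_def trancl_trans)

lemma edge_in_ordered_pairs: "(i, j) \<in> G \<Longrightarrow> (i, j) \<in> ordered_pairs"
  using observable_graph_subset not_both_ancestors[of i j] acyclic_obs
  by (auto simp: ordered_pairs_def acyclic_def)

lemma learned_edges_correct:
  assumes acc: "\<And>d. d \<in> set ds \<Longrightarrow> valid d \<and> accurate d"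
    and cover: "\<And>p. p \<in> ordered_pairs \<Longrightarrow> \<exists>d\<in>set ds. usable G p d"
  shows "learned_edges V K \<epsilon> ds = G"
proof -
  let ?S = "\<lambda>d. G \<inter> (V - target d) \<times> (V - target d)"
  have acyc: "acyclic (?S d)" for d using acyclic_obs by (rule acyclic_subset) auto
  have red: "transitive_reduction (closure_edges V K \<epsilon> d) = covers ((?S d)\<^sup>+)" if "d \<in> set ds" for d
    using acc[OF that] transitive_reduction_trancl[OF finite_subset[OF _ finite_G] acyc]
    by (simp add: closure_edges_accurate)
  show ?thesis
  proof
    have "covers ((?S d)\<^sup>+) \<subseteq> ?S d" for d
      by (rule covers_subset_if_trancl_eq) simp
    then show "learned_edges V K \<epsilon> ds \<subseteq> G"
      using red by (auto simp: learned_edges_def)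
  next
    show "G \<subseteq> learned_edges V K \<epsilon> ds"
    proof
      fix p assume "p \<in> G"
      then obtain i j where p: "p = (i, j)" "(i, j) \<in> G" by (cases p) auto
      then obtain d where d: "d \<in> set ds" "usable G (i, j) d"
        using cover edge_in_ordered_pairs by blast
      \<comment> \<open>\<open>usable\<close> puts the other parents of \<open>j\<close> into the
        target, so \<open>i\<close> is the only parent of \<open>j\<close> left in the induced
        subgraph.\<close>
      have "(i, j) \<in> covers ((?S d)\<^sup>+)"
        using p d(2) observable_graph_subset by (intro mem_covers_trancl acyc) (auto simp: usable_def)
      then show "p \<in> learned_edges V K \<epsilon> ds"
        using d(1) red p by (auto simp: learned_edges_def)
    qed
  qed
qed

lemma confounder_test_correct:
  assumes ij: "(i, j) \<in> ordered_pairs" and d: "valid d" "accurate d" "usable G (i, j) d"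
    and cond: "\<not> cond_inaccurate (target d) (target_val d) (observed d @ new)"
  shows "confounder_test K \<gamma> (observed d @ new) (intervened d i) (i, j) \<longleftrightarrow> confounded M i j"
proof -
  define W w where "W = target d" and "w = target_val d"
  define xs where "xs = observed d @ new"
  have W: "W \<subseteq> V" "w \<in> assignments M W"
    using d(1) by (auto simp: valid_def W_def w_def)
  have ij': "i \<in> V" "j \<in> V" "i \<noteq> j" "(j, i) \<notin> G\<^sup>+" "i \<notin> W" "j \<notin> W"
    using ij d(3) by (auto simp: ordered_pairs_def usable_def W_def)
  have pa: "(pa M i \<union> pa M j) - {i} \<subseteq> W"
    using d(3) ij' by (auto simp: usable_def W_def observable_graph_def)
  have nj: "j \<notin> pa M i" using ij' by (auto simp: observable_graph_def)
  have acc: "\<bar>emp_prob (intervened d i x) j y - do_prob M (insert i W) (w(i := x)) j y\<bar> \<le> \<gamma> / 4"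
    if "x \<in> {1..K}" "y \<in> {1..K}" for x y
    using d(2) ij' that unfolding accurate_def W_def w_def by fastforce
  have cnd: "\<not> cond_deviates W w xs i x j y" if "x \<in> {1..K}" "y \<in> {1..K}" for x y
    using cond ij' that unfolding cond_inaccurate_def W_def[symmetric] w_def[symmetric] xs_def[symmetric]
    by blast
  have nonneg: "0 \<le> do_prob M W w i x" for x by (simp add: do_prob_def)
  show ?thesis
  proof
    assume "confounder_test K \<gamma> (observed d @ new) (intervened d i) (i, j)"
    then obtain x y where xy: "x \<in> {1..K}" "y \<in> {1..K}" and pos: "sample_count xs (\<lambda>v. v i = x) > 0"
      and gap: "\<bar>emp_prob (intervened d i x) j y - emp_cond_prob xs i x j y\<bar> > \<gamma> / 2"
      unfolding confounder_test_def xs_def by auto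
    from cnd[OF xy] pos have c: "do_prob M W w i x \<noteq> 0"
      "\<bar>emp_cond_prob xs i x j y - do_cond_prob M W w i x j y\<bar> \<le> \<gamma> / 4"
      by (auto simp: cond_deviates_def split: if_splits)
    show "confounded M i j"
    proof (rule ccontr)
      assume "\<not> confounded M i j"
      then have "do_prob M (insert i W) (w(i := x)) j y = do_cond_prob M W w i x j y"
        using ij' nj W pa xy c(1) nonneg[of x] by (intro do_prob_unconfounded) auto
      with gap c(2) acc[OF xy] show False by linarith
    qed
  next
    assume "confounded M i j"
    then obtain x y where xy: "x \<in> {1..K}" "y \<in> {1..K}" and pos: "do_prob M W w i x > 0"
      and gap: "\<bar>do_prob M (insert i W) (w(i := x)) j y - do_cond_prob M W w i x j y\<bar> > \<gamma>"
      using confounder[unfolded confounder_gap_def,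
          THEN spec[of _ i], THEN spec[of _ j], THEN spec[of _ W],
          THEN mp, OF ij'(1), THEN mp, OF ij'(2), THEN mp, OF ij'(3), THEN mp, OF ij'(4),
          THEN mp, OF W(1), THEN mp, OF pa, THEN mp, OF ij'(5), THEN mp, OF ij'(6)] W(2)
      by metis
    from cnd[OF xy] pos have c: "sample_count xs (\<lambda>v. v i = x) > 0"
      "\<bar>emp_cond_prob xs i x j y - do_cond_prob M W w i x j y\<bar> \<le> \<gamma> / 4"
      by (auto simp: cond_deviates_def split: if_splits)
    have "\<bar>emp_prob (intervened d i x) j y - emp_cond_prob xs i x j y\<bar> > \<gamma> / 2"
      using c(2) gap acc[OF xy] by linarith
    then show "confounder_test K \<gamma> (observed d @ new) (intervened d i) (i, j)"
      unfolding confounder_test_def xs_def[symmetric] prod.case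
      using xy c(1) by blast
  qed
qed

lemma test_pairs_ordered:
  "p \<in> test_pairs V G ds \<Longrightarrow> p \<in> ordered_pairs"
  using not_both_ancestors by (auto simp: test_pairs_def orient_def ordered_pairs_def split: if_splits)

lemma confounder_edges_correct:
  assumes sel: "\<And>p I. I \<noteq> {} \<Longrightarrow> sel p I \<in> I"
    and acc: "\<And>d. d \<in> set ds \<Longrightarrow> valid d \<and> accurate d"
    and cover: "\<And>p. p \<in> ordered_pairs \<Longrightarrow> \<exists>d\<in>set ds. usable G p d"
    and cond: "\<And>p. p \<in> test_pairs V G ds \<Longrightarrow>
      let k = used_index sel G ds p
      in \<not> cond_inaccurate (target (ds ! k)) (target_val (ds ! k)) (observed (ds ! k) @ new k)"
  shows "confounder_edges V K \<gamma> sel G ds new = snd (causal_graph M)"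
proof -
  have test: "confounder_test K \<gamma>
      (observed (ds ! used_index sel G ds (i, j)) @ new (used_index sel G ds (i, j)))
      (intervened (ds ! used_index sel G ds (i, j)) i) (i, j) \<longleftrightarrow> confounded M i j"
    if p: "(i, j) \<in> test_pairs V G ds" for i j
    using test_pairs_ordered[OF p] used_index_lt[OF sel p] acc cond[OF p]
    by (intro confounder_test_correct) (auto simp: Let_def)
  have edges: "confounder_edges V K \<gamma> sel G ds new =
      {{i, j} |i j. (i, j) \<in> test_pairs V G ds \<and> confounded M i j}"
    unfolding confounder_edges_def using test by blast
  also have "\<dots> = {{i, j} |i j. i \<in> V \<and> j \<in> V \<and> confounded M i j}"
  proof (intro equalityI subsetI)
    fix e assume "e \<in> {{i, j} |i j. (i, j) \<in> test_pairs V G ds \<and> confounded M i j}"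
    then show "e \<in> {{i, j} |i j. i \<in> V \<and> j \<in> V \<and> confounded M i j}"
      using test_pairs_ordered by (fastforce simp: ordered_pairs_def)
  next
    fix e assume "e \<in> {{i, j} |i j. i \<in> V \<and> j \<in> V \<and> confounded M i j}"
    then obtain a b where "e = {a, b}" "a \<in> V" "b \<in> V" "confounded M a b" by auto
    then obtain i j where ij: "e = {i, j}" "i \<in> V" "j \<in> V" "i < j" "confounded M i j"
      by (metis confounded_def inf_commute insert_commute linorder_neqE)
    \<comment> \<open>The algorithm may test the pair in the reverse orientation, which changes
      neither the two-element set nor confounding.\<close>
    obtain a b where ab: "orient G (i, j) = (a, b)" by fastforce
    then have "{a, b} = {i, j}" "confounded M a b"
      using ij(5) by (auto simp: orient_def confounded_def split: if_splits)
    moreover have "(a, b) \<in> ordered_pairs"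
      using ab ij not_both_ancestors by (auto simp: orient_def ordered_pairs_def split: if_splits)
    then obtain d where "d \<in> set ds" "usable G (a, b) d" using cover by blast
    then have "usable_indices G ds (a, b) \<noteq> {}"
      by (auto simp: usable_indices_def in_set_conv_nth)
    then have "(a, b) \<in> test_pairs V G ds"
      using ij ab by (force simp: test_pairs_def)
    ultimately show "e \<in> {{i, j} |i j. (i, j) \<in> test_pairs V G ds \<and> confounded M i j}"
      using ij(1) by blast
  qed
  finally show ?thesis by (simp add: causal_graph_def)
qed

section \<open>Failure probabilities for the chosen sample sizes\<close>

lemma n_pos: "0 < n"
  using finite_obs Y_obs by (auto simp: card_gt_0_iff)

lemma K_pos: "1 \<le> K"
  using dom_size_ge by simp

lemma exp_neg_ln_bound:
  fixes a \<delta> L :: real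
  assumes "0 < \<delta>" "0 < a" "ln (a / \<delta>) \<le> L"
  shows "exp (- L) \<le> \<delta> / a"
proof -
  have "exp (- L) \<le> exp (- ln (a / \<delta>))"
    using assms(3) by (subst exp_le_cancel_iff) linarith
  also have "\<dots> = \<delta> / a" using assms(1,2) by (simp add: exp_minus)
  finally show ?thesis .
qed

text \<open>The 2 inside the logarithm pays for the two tails.\<close>

lemma emp_prob_bound:
  assumes "0 < \<delta>" "0 < t" "ln (2 * real n * (real K)\<^sup>2 / \<delta>) \<le> 2 * t\<^sup>2 * real m"
  shows "measure_pmf.prob (replicate_pmf m p)
      {xs. t < \<bar>emp_prob xs j y - measure_pmf.prob p {v. v j = y}\<bar>} \<le> \<delta> / (real n * (real K)\<^sup>2)"
proof -
  have "exp (- (2 * t\<^sup>2 * real m)) \<le> \<delta> / (2 * real n * (real K)\<^sup>2)"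
    using assms n_pos K_pos by (intro exp_neg_ln_bound) auto
  then have "2 * exp (- (2 * t\<^sup>2 * real m)) \<le> 2 * (\<delta> / (2 * real n * (real K)\<^sup>2))"
    by linarith
  then have "2 * exp (- 2 * t\<^sup>2 * real m) \<le> \<delta> / (real n * (real K)\<^sup>2)"
    by simp
  with emp_prob_deviation[of t m p j y] assms(2) show ?thesis
    by (meson less_imp_le order.trans)
qed

text \<open>One estimate fails with probability at most \<open>\<delta> / (n * K^2)\<close>. There
  are at most \<open>n^2 * K^2\<close> interventional estimates per iteration, which gives
  \<open>n * \<delta>1\<close>, but only \<open>n * K\<close> observational ones, which
  \<open>\<delta>2\<close> more than covers.\<close>

lemma prob_inaccurate_le:
  fixes c :: "'v set \<Rightarrow> 'v \<Rightarrow> nat"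
  assumes "0 < \<delta>1" "0 < \<delta>2"
  defines "A \<equiv> size_A n K \<epsilon> \<gamma> \<delta>1" and "B \<equiv> size_B n K \<epsilon> \<delta>2"
  shows "measure_pmf.prob (draw_pmf (do_dist M) V K A B dmax c) {d. \<not> accurate d}
    \<le> real n * \<delta>1 + \<delta>2"
  unfolding draw_pmf_def
proof (rule prob_bind_pmf_le)
  fix W assume "W \<in> set_pmf (random_vertex_set V dmax)"
  let ?D = "data_pmf (do_dist M) V K A B c W"
  let ?L = "\<lambda>\<delta>. ln (2 * real n * (real K)\<^sup>2 / \<delta>)"
  let ?g = "\<lambda>d j y. \<epsilon> / 4 < \<bar>emp_prob (observed d) j y - do_prob M W (c W) j y\<bar>"
  let ?h = "\<lambda>d i x j y. min \<epsilon> \<gamma> / 4 <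
     \<bar>emp_prob (intervened d i x) j y - do_prob M (insert i W) ((c W)(i := x)) j y\<bar>"
  let ?I1 = "V \<times> {1..K}" and ?I2 = "(V - W) \<times> {1..K} \<times> V \<times> {1..K}"
  have "measure_pmf.prob ?D {d. \<not> accurate d} \<le>
     measure_pmf.prob ?D ({d. \<exists>(j, y)\<in>?I1. ?g d j y} \<union> {d. \<exists>(i, x, j, y)\<in>?I2. ?h d i x j y})"
  proof -
    have "{d. \<not> accurate d} \<inter> set_pmf ?D \<subseteq>
       {d. \<exists>(j, y)\<in>?I1. ?g d j y} \<union> {d. \<exists>(i, x, j, y)\<in>?I2. ?h d i x j y}"
    proof
      fix d assume d: "d \<in> {d. \<not> accurate d} \<inter> set_pmf ?D"
      then have t: "target d = W" "target_val d = c W"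
        using target_data_pmf[of d] by blast+
      from d have "\<not> accurate d" by simp
      then show "d \<in> {d. \<exists>(j, y)\<in>?I1. ?g d j y} \<union> {d. \<exists>(i, x, j, y)\<in>?I2. ?h d i x j y}"
        unfolding accurate_def t split_beta
        by (simp only: de_Morgan_conj Set.ball_simps(10) not_le Un_iff mem_Collect_eq)
    qed
    then have "measure_pmf.prob ?D ({d. \<not> accurate d} \<inter> set_pmf ?D) \<le>
     measure_pmf.prob ?D ({d. \<exists>(j, y)\<in>?I1. ?g d j y} \<union> {d. \<exists>(i, x, j, y)\<in>?I2. ?h d i x j y})"
      by (intro measure_pmf.finite_measure_mono) auto
    then show ?thesis by (simp add: measure_Int_set_pmf)
  qed
  also have "\<dots> \<le> measure_pmf.prob ?D {d. \<exists>(j, y)\<in>?I1. ?g d j y} +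
     measure_pmf.prob ?D {d. \<exists>(i, x, j, y)\<in>?I2. ?h d i x j y}"
    by (intro measure_Un_le) auto
  also have "\<dots> \<le> \<delta>2 + real n * \<delta>1"
  proof (rule add_mono)
    have "8 / \<epsilon>\<^sup>2 * ?L \<delta>2 \<le> real B"
      unfolding B_def size_B_def by linarith
    then have B: "?L \<delta>2 \<le> 2 * (\<epsilon> / 4)\<^sup>2 * real B"
      using eps by (simp add: field_simps)
    have "measure_pmf.prob ?D {d. \<exists>p\<in>?I1. case p of (j, y) \<Rightarrow> ?g d j y} \<le>
        real (card ?I1) * (\<delta>2 / (real n * (real K)\<^sup>2))"
    proof (intro prob_Bex_le)
      fix p assume "p \<in> ?I1"
      obtain j y where p: "p = (j, y)" by fastforce
      have "measure_pmf.prob ?D {d. ?g d j y} = measure_pmf.prob (map_pmf observed ?D)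
          {xs. \<epsilon> / 4 < \<bar>emp_prob xs j y - do_prob M W (c W) j y\<bar>}"
        by (simp add: vimage_def)
      also have "\<dots> \<le> \<delta>2 / (real n * (real K)\<^sup>2)"
        unfolding map_observed_data_pmf do_prob_def using assms eps B by (intro emp_prob_bound) auto
      finally show "measure_pmf.prob ?D {d. case p of (j, y) \<Rightarrow> ?g d j y} \<le> \<delta>2 / (real n * (real K)\<^sup>2)"
        by (simp only: p prod.case)
    qed (use finite_obs in auto)
    also have "\<dots> = \<delta>2 / real K"
      using n_pos K_pos by (simp add: card_cartesian_product power2_eq_square)
    also have "\<dots> \<le> \<delta>2 / 1"
      using K_pos assms by (intro divide_left_mono) auto
    finally show "measure_pmf.prob ?D {d. \<exists>(j, y)\<in>?I1. ?g d j y} \<le> \<delta>2" by simp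
  next
    define t where "t = min \<epsilon> \<gamma> / 4"
    have t: "0 < t" using eps gam by (simp add: t_def)
    \<comment> \<open>A tolerance of \<open>g / 4\<close> requires a factor
      \<open>1 / (2 * (g / 4)\<^sup>2) = 8 / g\<^sup>2\<close> in the sample size; here
      \<open>g\<close> is the smaller gap.\<close>
    have max: "max (8 / \<epsilon>\<^sup>2) (8 / \<gamma>\<^sup>2) = 1 / (2 * t\<^sup>2)"
    proof (cases "\<epsilon> \<le> \<gamma>")
      case True
      then have "8 / \<gamma>\<^sup>2 \<le> 8 / \<epsilon>\<^sup>2" using eps by (intro divide_left_mono power_mono) auto
      with True show ?thesis using eps by (simp add: t_def max_def field_simps)
    next
      case False
      then have "8 / \<epsilon>\<^sup>2 \<le> 8 / \<gamma>\<^sup>2" using gam by (intro divide_left_mono power_mono) auto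
      with False show ?thesis using gam eps by (simp add: t_def max_def field_simps)
    qed
    have "max (8 / \<epsilon>\<^sup>2) (8 / \<gamma>\<^sup>2) * ?L \<delta>1 \<le> real A"
      unfolding A_def size_A_def by linarith
    then have A: "?L \<delta>1 \<le> 2 * t\<^sup>2 * real A"
      unfolding max using t by (simp add: field_simps)
    have "measure_pmf.prob ?D {d. \<exists>p\<in>?I2. case p of (i, x, j, y) \<Rightarrow> ?h d i x j y} \<le>
        real (card ?I2) * (\<delta>1 / (real n * (real K)\<^sup>2))"
    proof (intro prob_Bex_le)
      fix p assume p': "p \<in> ?I2"
      obtain i x j y where p: "p = (i, x, j, y)" by (metis prod_cases4)
      have "measure_pmf.prob ?D {d. ?h d i x j y} = measure_pmf.prob (map_pmf (\<lambda>d. intervened d i x) ?D)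
          {xs. t < \<bar>emp_prob xs j y - do_prob M (insert i W) ((c W)(i := x)) j y\<bar>}"
        by (simp add: vimage_def t_def)
      also have "map_pmf (\<lambda>d. intervened d i x) ?D =
          replicate_pmf A (do_dist M (insert i W) ((c W)(i := x)))"
        using p' p by (intro map_intervened_data_pmf finite_obs) auto
      also have "measure_pmf.prob \<dots>
          {xs. t < \<bar>emp_prob xs j y - do_prob M (insert i W) ((c W)(i := x)) j y\<bar>}
          \<le> \<delta>1 / (real n * (real K)\<^sup>2)"
        unfolding do_prob_def using assms t A by (intro emp_prob_bound) auto
      finally show "measure_pmf.prob ?D {d. case p of (i, x, j, y) \<Rightarrow> ?h d i x j y}
          \<le> \<delta>1 / (real n * (real K)\<^sup>2)"
        by (simp only: p prod.case)
    qed (use finite_obs in auto)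
    also have "\<dots> \<le> real (n * (K * (n * K))) * (\<delta>1 / (real n * (real K)\<^sup>2))"
    proof (intro mult_right_mono)
      have "card (V - W) \<le> n" using finite_obs by (intro card_mono) auto
      then show "real (card ?I2) \<le> real (n * (K * (n * K)))"
        by (simp add: card_cartesian_product mult_right_mono)
    qed (use assms in auto)
    also have "\<dots> = real n * \<delta>1"
      using n_pos K_pos by (simp add: power2_eq_square)
    finally show "measure_pmf.prob ?D {d. \<exists>(i, x, j, y)\<in>?I2. ?h d i x j y} \<le> real n * \<delta>1" .
  qed
  finally show "measure_pmf.prob ?D {d. \<not> accurate d} \<le> real n * \<delta>1 + \<delta>2" by simp
qed (use assms in simp)

text \<open>The sample size may exceed \<open>C\<close>, since a topped-up data set holds
  \<open>max B C\<close> samples.\<close>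

lemma prob_cond_inaccurate_le:
  assumes W: "W \<subseteq> V" "w \<in> assignments M W" and \<delta>: "0 < \<delta>3" "0 < \<delta>4"
    and m: "size_C n K \<gamma> \<eta> \<delta>3 \<delta>4 \<le> m"
  shows "measure_pmf.prob (replicate_pmf m (do_dist M W w)) {xs. cond_inaccurate W w xs} \<le> \<delta>3 + \<delta>4"
proof -
  let ?L = "\<lambda>\<delta>. ln (2 * (real n)\<^sup>2 * (real K)\<^sup>2 / \<delta>)"
  let ?p = "replicate_pmf m (do_dist M W w)"
  let ?I = "V \<times> {1..K} \<times> V \<times> {1..K}"
  let ?Q = "\<lambda>q xs. case q of (i, x, j, y) \<Rightarrow> cond_deviates W w xs i x j y"
  let ?b = "(\<delta>3 + \<delta>4) / ((real n)\<^sup>2 * (real K)\<^sup>2)"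
  have "16 / (\<eta> * \<gamma>\<^sup>2) * ?L \<delta>3 + 1 / (2 * \<eta>\<^sup>2) * ?L \<delta>4 \<le> real (size_C n K \<gamma> \<eta> \<delta>3 \<delta>4)"
    unfolding size_C_def by linarith
  with m have m': "16 / (\<eta> * \<gamma>\<^sup>2) * ?L \<delta>3 + 1 / (2 * \<eta>\<^sup>2) * ?L \<delta>4 \<le> real m" by linarith
  have e: "exp (- ?L \<delta>) \<le> \<delta> / (2 * (real n)\<^sup>2 * (real K)\<^sup>2)" if "0 < \<delta>" for \<delta>
    using that n_pos K_pos by (intro exp_neg_ln_bound) auto
  have "measure_pmf.prob ?p {xs. \<exists>q\<in>?I. ?Q q xs} \<le> real (card ?I) * ?b"
  proof (intro prob_Bex_le)
    fix q assume q': "q \<in> ?I"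
    obtain i x j y where q: "q = (i, x, j, y)" by (metis prod_cases4)
    have a: "do_prob M W w i x = 0 \<or> \<eta> \<le> do_prob M W w i x"
      using positivity W q' q unfolding positivity_def by auto
    have "measure_pmf.prob ?p {xs. ?Q q xs} \<le> 2 * exp (- ?L \<delta>3) + 2 * exp (- ?L \<delta>4)"
      using emp_cond_prob_deviation[OF eta gam a[unfolded do_prob_def] m', of j y]
      unfolding q prod.case cond_deviates_def do_cond_prob_def do_prob_def .
    also have "\<dots> \<le> 2 * (\<delta>3 / (2 * (real n)\<^sup>2 * (real K)\<^sup>2)) + 2 * (\<delta>4 / (2 * (real n)\<^sup>2 * (real K)\<^sup>2))"
      using e[OF \<delta>(1)] e[OF \<delta>(2)] by linarith
    also have "\<dots> = ?b" by (simp add: add_divide_distrib)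
    finally show "measure_pmf.prob ?p {xs. ?Q q xs} \<le> ?b" .
  qed (use finite_obs in auto)
  also have "\<dots> = \<delta>3 + \<delta>4"
    using n_pos K_pos by (simp add: card_cartesian_product power2_eq_square)
  also have "{xs. \<exists>q\<in>?I. ?Q q xs} = {xs. cond_inaccurate W w xs}"
    unfolding cond_inaccurate_def ..
  finally show ?thesis .
qed

text \<open>Given the target, the stored samples followed by fresh ones form an i.i.d. sample of
  size \<open>B + (C - B)\<close>. The integral is the failure probability of that sample, so
  reusing the stored part costs nothing.\<close>

lemma nn_integral_cond_inaccurate_le:
  fixes c :: "'v set \<Rightarrow> 'v \<Rightarrow> nat"
  assumes c: "\<And>W. W \<subseteq> V \<Longrightarrow> c W \<in> assignments M W" and \<delta>: "0 < \<delta>3" "0 < \<delta>4"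
  defines "C \<equiv> size_C n K \<gamma> \<eta> \<delta>3 \<delta>4"
  shows "(\<integral>\<^sup>+d. emeasure (replicate_pmf (C - B) (do_dist M (target d) (target_val d)))
        {new. cond_inaccurate (target d) (target_val d) (observed d @ new)}
        \<partial>draw_pmf (do_dist M) V K A B dmax c) \<le> ennreal (\<delta>3 + \<delta>4)"
proof -
  let ?f = "\<lambda>W w xs. emeasure (replicate_pmf (C - B) (do_dist M W w)) {new. cond_inaccurate W w (xs @ new)}"
  have "(\<integral>\<^sup>+d. ?f (target d) (target_val d) (observed d) \<partial>data_pmf (do_dist M) V K A B c W) \<le> ennreal (\<delta>3 + \<delta>4)"
    if W: "W \<in> set_pmf (random_vertex_set V dmax)" for W
  proof -
    let ?D = "data_pmf (do_dist M) V K A B c W"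
    have "(\<integral>\<^sup>+d. ?f (target d) (target_val d) (observed d) \<partial>?D) = (\<integral>\<^sup>+d. ?f W (c W) (observed d) \<partial>?D)"
      by (intro nn_integral_cong_AE AE_pmfI) (auto dest!: target_data_pmf)
    also have "\<dots> = (\<integral>\<^sup>+xs. ?f W (c W) xs \<partial>map_pmf observed ?D)"
      by simp
    also have "\<dots> = (\<integral>\<^sup>+xs. ?f W (c W) xs \<partial>replicate_pmf B (do_dist M W (c W)))"
      by (simp only: map_observed_data_pmf)
    also have "\<dots> = emeasure (replicate_pmf (B + (C - B)) (do_dist M W (c W))) {xs. cond_inaccurate W (c W) xs}"
      by (simp add: replicate_pmf_distrib emeasure_bind_pmf vimage_def flip: map_pmf_def)
    also have "\<dots> \<le> ennreal (\<delta>3 + \<delta>4)"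
      unfolding measure_pmf.emeasure_eq_measure
      using set_random_vertex_set[OF W] c \<delta>
      by (intro ennreal_leI prob_cond_inaccurate_le) (auto simp: C_def)
    finally show ?thesis .
  qed
  then have "(\<integral>\<^sup>+W. (\<integral>\<^sup>+d. ?f (target d) (target_val d) (observed d) \<partial>data_pmf (do_dist M) V K A B c W)
       \<partial>random_vertex_set V dmax) \<le> (\<integral>\<^sup>+W. ennreal (\<delta>3 + \<delta>4) \<partial>random_vertex_set V dmax)"
    by (intro nn_integral_mono_AE AE_pmfI)
  then show ?thesis
    by (simp add: draw_pmf_def nn_integral_bind_pmf)
qed

lemma prob_not_usable_le:
  assumes "p \<in> ordered_pairs"
  shows "measure_pmf.prob (draw_pmf P V K A B dmax c) {d. \<not> usable G p d} \<le> 1 - 1 / (16 * (real dmax)\<^sup>2)"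
proof -
  obtain i j where p: "p = (i, j)" by fastforce
  with assms have ij: "i \<in> V" "j \<in> V" "i \<noteq> j" "(j, i) \<notin> G\<^sup>+"
    by (auto simp: ordered_pairs_def)
  have irr: "(k, k) \<notin> G" for k using acyclic_obs by (auto simp: acyclic_def)
  let ?S = "{u. (u, i) \<in> G \<or> (u, j) \<in> G} - {i}"
  have deg: "card {u. (u, v) \<in> G} \<le> dmax" if "v \<in> V" for v
  proof -
    have "finite {u. (u, v) \<in> G \<or> (v, u) \<in> G}"
      using finite_obs observable_graph_subset by (rule_tac finite_subset[of _ V]) auto
    then have "card {u. (u, v) \<in> G} \<le> vertex_degree G v"
      unfolding vertex_degree_def by (intro card_mono) auto
    then show ?thesis using degree[OF that] by linarith
  qed
  have "finite {u. (u, v) \<in> G}" for v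
    using finite_obs observable_graph_subset by (rule_tac finite_subset[of _ V]) auto
  then have "card ?S \<le> card ({u. (u, i) \<in> G} \<union> {u. (u, j) \<in> G})"
    by (intro card_mono) auto
  also have "\<dots> \<le> 2 * dmax"
    using card_Un_le[of "{u. (u, i) \<in> G}" "{u. (u, j) \<in> G}"] deg[OF ij(1)] deg[OF ij(2)] by linarith
  finally have S: "card ?S \<le> 2 * dmax" .
  \<comment> \<open>The orientation matters here: \<open>j\<close> is no parent of \<open>i\<close>,
    and no vertex is its own parent, so \<open>?S\<close> contains neither \<open>i\<close> nor
    \<open>j\<close>.\<close>
  have "1 / (16 * (real dmax)\<^sup>2) \<le>
     measure_pmf.prob (random_vertex_set V dmax) {W. ?S \<subseteq> W \<and> i \<notin> W \<and> j \<notin> W}"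
    using ij irr observable_graph_subset dmax S finite_obs
    by (intro prob_random_vertex_set_ge) auto
  also have "\<dots> = measure_pmf.prob (draw_pmf P V K A B dmax c) {d. usable G p d}"
    unfolding map_target_draw_pmf[of P V K A B dmax c, symmetric] by (simp add: vimage_def usable_def p)
  finally show ?thesis
    using measure_pmf.prob_compl[of "{d. usable G p d}" "draw_pmf P V K A B dmax c"]
    by (simp add: Compl_eq_Diff_UNIV[symmetric] Collect_neg_eq)
qed

lemma usable_prob_bound: "1 / (16 * (real dmax)\<^sup>2) \<le> 1 / 16"
proof -
  have "1 \<le> (real dmax)\<^sup>2" using dmax by simp
  then have "1 / (16 * (real dmax)\<^sup>2) \<le> 1 / (16 * 1)"
    using dmax by (intro divide_left_mono mult_left_mono) auto
  then show ?thesis by simp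
qed

text \<open>With \<open>X\<close> iterations, \<open>1 - r \<le> exp (- r)\<close> would give the
  power of \<open>n\<close> exactly. Rounding down loses at most one iteration, that is, a factor
  \<open>exp r\<close>; this is the 2 in the numerator.\<close>

lemma coverage_bound:
  fixes \<alpha> :: real
  assumes "0 < \<alpha>"
  defines "T \<equiv> nat \<lfloor>8 * \<alpha> * real dmax * ln (real n)\<rfloor>"
  shows "(real n)\<^sup>2 * (1 - 1 / (16 * (real dmax)\<^sup>2)) ^ T \<le> 2 / real n powr (\<alpha> / (2 * real dmax) - 2)"
proof -
  define X where "X = 8 * \<alpha> * real dmax * ln (real n)"
  define r where "r = 1 / (16 * (real dmax)\<^sup>2)"
  have r: "0 \<le> r" "r \<le> 1 / 16"
    using usable_prob_bound unfolding r_def by auto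
  have T: "X - 1 \<le> real T" unfolding T_def X_def by linarith
  have rX: "r * X = \<alpha> / (2 * real dmax) * ln (real n)"
    using dmax by (simp add: r_def X_def power2_eq_square)
  have "(1 - r) ^ T \<le> exp (- r) ^ T"
    using r exp_ge_add_one_self[of "- r"] by (intro power_mono) auto
  also have "\<dots> = exp (- (r * real T))" by (simp add: mult.commute flip: exp_of_nat_mult)
  also have "\<dots> \<le> exp (r - r * X)"
    using mult_left_mono[OF T r(1)] by (simp add: algebra_simps)
  also have "\<dots> = exp r * exp (- (r * X))" by (simp add: exp_diff exp_minus field_simps)
  also have "\<dots> \<le> 2 * exp (- (r * X))"
  proof (intro mult_right_mono)
    have "exp r \<le> 1 + r + r\<^sup>2" using r by (intro exp_bound) auto
    moreover have "r\<^sup>2 \<le> (1 / 16)\<^sup>2" using r by (intro power_mono) auto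
    ultimately show "exp r \<le> 2" using r by (simp add: power2_eq_square)
  qed auto
  also have "exp (- (r * X)) = real n powr (- (\<alpha> / (2 * real dmax)))"
    using n_pos by (simp add: rX powr_def)
  finally have "(real n)\<^sup>2 * (1 - r) ^ T \<le> (real n)\<^sup>2 * (2 * real n powr (- (\<alpha> / (2 * real dmax))))"
    by (intro mult_left_mono) auto
  also have "\<dots> = 2 * (real n powr 2 * real n powr (- (\<alpha> / (2 * real dmax))))"
    using n_pos by (simp add: powr_realpow[of _ 2, simplified])
  also have "\<dots> = 2 * real n powr (- (\<alpha> / (2 * real dmax) - 2))"
    by (simp only: powr_add[symmetric]) simp
  also have "\<dots> = 2 / real n powr (\<alpha> / (2 * real dmax) - 2)"
    by (simp only: powr_minus_divide)
  finally show ?thesis by (simp add: r_def)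
qed

lemma learn_causal_graph_prob:
  fixes c :: "nat \<Rightarrow> 'v set \<Rightarrow> 'v \<Rightarrow> nat"
  assumes c: "\<And>k W. W \<subseteq> V \<Longrightarrow> c k W \<in> assignments M W"
    and sel: "\<And>p I. I \<noteq> {} \<Longrightarrow> sel p I \<in> I"
    and pos: "0 < \<alpha>" "0 < \<delta>1" "0 < \<delta>2" "0 < \<delta>3" "0 < \<delta>4"
  shows "measure_pmf.prob (learn_causal_graph (do_dist M) V K \<epsilon> \<gamma> \<eta> c sel \<alpha> dmax \<delta>1 \<delta>2 \<delta>3 \<delta>4)
      {(G, s). G = causal_graph M}
    \<ge> 1 - 2 / real n powr (\<alpha> / (2 * real dmax) - 2)
        - 8 * \<alpha> * real dmax * ln (real n) * (real n * \<delta>1 + (\<delta>2 + \<delta>3 + \<delta>4))"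
proof -
  define A B C where "A = size_A n K \<epsilon> \<gamma> \<delta>1" and "B = size_B n K \<epsilon> \<delta>2" and "C = size_C n K \<gamma> \<eta> \<delta>3 \<delta>4"
  define X where "X = 8 * \<alpha> * real dmax * ln (real n)"
  define T where "T = nat \<lfloor>X\<rfloor>"
  let ?D = "draws_pmf (do_dist M) V K A B dmax c T"
  \<comment> \<open>Only failures already visible in the stored data belong here; they cost
    \<open>\<delta>1\<close>, \<open>\<delta>2\<close> and the coverage term, while
    \<open>\<delta>3\<close> and \<open>\<delta>4\<close> are charged to the conditional estimates
    after the top-up.\<close>
  define Bad where "Bad = {ds. \<exists>d\<in>set ds. \<not> accurate d} \<union> {ds. \<exists>p\<in>ordered_pairs. \<forall>d\<in>set ds. \<not> usable G p d}"
  define b where "b = 2 / real n powr (\<alpha> / (2 * real dmax) - 2)"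
  have pairs: "ordered_pairs \<subseteq> V \<times> V" by (auto simp: ordered_pairs_def)
  have "measure_pmf.prob ?D Bad \<le> measure_pmf.prob ?D {ds. \<exists>d\<in>set ds. \<not> accurate d} +
      measure_pmf.prob ?D {ds. \<exists>p\<in>ordered_pairs. \<forall>d\<in>set ds. \<not> usable G p d}"
    unfolding Bad_def by (intro measure_Un_le) auto
  also have "\<dots> \<le> real T * (real n * \<delta>1 + \<delta>2) + b"
  proof (rule add_mono)
    show "measure_pmf.prob ?D {ds. \<exists>d\<in>set ds. \<not> accurate d} \<le> real T * (real n * \<delta>1 + \<delta>2)"
      using pos unfolding A_def B_def by (intro prob_draws_ex_le prob_inaccurate_le)
    have "measure_pmf.prob ?D {ds. \<exists>p\<in>ordered_pairs. \<forall>d\<in>set ds. \<not> usable G p d} \<le>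
        real (card ordered_pairs) * (1 - 1 / (16 * (real dmax)\<^sup>2)) ^ T"
      using finite_subset[OF pairs] finite_obs
      by (intro prob_Bex_le prob_draws_all_le prob_not_usable_le) auto
    also have "\<dots> \<le> (real n)\<^sup>2 * (1 - 1 / (16 * (real dmax)\<^sup>2)) ^ T"
    proof (intro mult_right_mono zero_le_power)
      have "card ordered_pairs \<le> card (V \<times> V)"
        using pairs finite_obs by (intro card_mono) auto
      also have "\<dots> = n\<^sup>2" by (simp add: card_cartesian_product power2_eq_square)
      finally show "real (card ordered_pairs) \<le> (real n)\<^sup>2"
        by (metis of_nat_le_iff of_nat_power)
      show "0 \<le> 1 - 1 / (16 * (real dmax)\<^sup>2)"
        using usable_prob_bound by linarith
    qed
    also have "\<dots> \<le> b"
      unfolding b_def T_def X_def by (rule coverage_bound[OF pos(1)])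
    finally show "measure_pmf.prob ?D {ds. \<exists>p\<in>ordered_pairs. \<forall>d\<in>set ds. \<not> usable G p d} \<le> b" .
  qed
  finally have stage1: "measure_pmf.prob ?D Bad \<le> real T * (real n * \<delta>1 + \<delta>2) + b" .
  have "1 - (real T * (real n * \<delta>1 + \<delta>2) + b) - real T * (\<delta>3 + \<delta>4) \<le>
     measure_pmf.prob (learn_causal_graph_sized (do_dist M) V K \<epsilon> \<gamma> A B C c sel \<alpha> dmax)
       {(G', s). G' = causal_graph M}"
    unfolding T_def X_def
  proof (rule prob_learn_causal_graph_sized_ge[where Bad = Bad and
        bad = "\<lambda>d new. cond_inaccurate (target d) (target_val d) (observed d @ new)"])
    fix ds new
    assume ds: "ds \<in> set_pmf (draws_pmf (do_dist M) V K A B dmax c (nat \<lfloor>8 * \<alpha> * real dmax * ln (real n)\<rfloor>))"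
      and "ds \<notin> Bad"
      and cond: "\<And>p. p \<in> test_pairs V (learned_edges V K \<epsilon> ds) ds \<Longrightarrow>
         \<not> cond_inaccurate (target (ds ! used_index sel (learned_edges V K \<epsilon> ds) ds p))
            (target_val (ds ! used_index sel (learned_edges V K \<epsilon> ds) ds p))
            (observed (ds ! used_index sel (learned_edges V K \<epsilon> ds) ds p) @
              new (used_index sel (learned_edges V K \<epsilon> ds) ds p))"
    then have acc: "\<And>d. d \<in> set ds \<Longrightarrow> accurate d"
      and cover: "\<And>p. p \<in> ordered_pairs \<Longrightarrow> \<exists>d\<in>set ds. usable G p d"
      by (auto simp: Bad_def)
    have "valid d" if d: "d \<in> set ds" for d
    proof -
      obtain j where "j < length ds" "d = ds ! j" using d by (auto simp: in_set_conv_nth)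
      then have "d \<in> set_pmf (draw_pmf (do_dist M) V K A B dmax (c j))"
        using nth_draws_pmf[OF ds] length_draws_pmf[OF ds] by auto
      then show ?thesis by (rule draw_pmfE) (metis valid_def c)
    qed
    then have va: "valid d \<and> accurate d" if "d \<in> set ds" for d using acc that by blast
    have G: "learned_edges V K \<epsilon> ds = G"
      using va cover by (rule learned_edges_correct)
    have "confounder_edges V K \<gamma> sel G ds new = snd (causal_graph M)"
      using cond unfolding G
      by (intro confounder_edges_correct sel va cover) (auto simp: Let_def)
    then show "(learned_edges V K \<epsilon> ds, confounder_edges V K \<gamma> sel (learned_edges V K \<epsilon> ds) ds new) = causal_graph M"
      by (simp add: G causal_graph_def)
  next
    show "measure_pmf.prob (draws_pmf (do_dist M) V K A B dmax c (nat \<lfloor>8 * \<alpha> * real dmax * ln (real n)\<rfloor>)) Bad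
      \<le> real (nat \<lfloor>8 * \<alpha> * real dmax * ln (real n)\<rfloor>) * (real n * \<delta>1 + \<delta>2) + b"
      using stage1 by (simp add: T_def X_def)
  next
    fix k
    show "(\<integral>\<^sup>+d. emeasure (replicate_pmf (C - B) (do_dist M (target d) (target_val d)))
        {new. cond_inaccurate (target d) (target_val d) (observed d @ new)}
        \<partial>draw_pmf (do_dist M) V K A B dmax (c k)) \<le> ennreal (\<delta>3 + \<delta>4)"
      unfolding C_def using c pos by (intro nn_integral_cond_inaccurate_le)
  qed (use finite_obs sel pos in auto)
  moreover have "real T \<le> X"
    using n_pos pos(1) dmax unfolding T_def X_def by (intro of_nat_floor mult_nonneg_nonneg ln_ge_zero) auto
  then have "real T * (real n * \<delta>1 + (\<delta>2 + \<delta>3 + \<delta>4)) \<le> X * (real n * \<delta>1 + (\<delta>2 + \<delta>3 + \<delta>4))"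
    using pos by (intro mult_right_mono) auto
  ultimately show ?thesis
    unfolding learn_causal_graph_def A_def[symmetric] B_def[symmetric] C_def[symmetric]
      X_def[symmetric] b_def[symmetric]
    by (simp add: algebra_simps)
qed

end

section \<open>The final bounds and the choice of parameters\<close>

theorem theorem3:
  fixes M :: "('v::linorder, 'u, 'e) scm" and Y :: 'v
    and q :: "'v \<Rightarrow> nat pmf"
    and \<epsilon> \<gamma> \<eta> :: real
    and dmax n K :: nat
    and c :: "nat \<Rightarrow> 'v set \<Rightarrow> 'v \<Rightarrow> nat"
    and sel :: "'v \<times> 'v \<Rightarrow> nat set \<Rightarrow> nat"
    and learn :: "real \<Rightarrow> nat \<Rightarrow> real \<Rightarrow> real \<Rightarrow> real \<Rightarrow> real \<Rightarrow> ('v mixed_graph \<times> nat) pmf"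
  assumes "semi_markovian_scm M Y"
    and "\<And>i. i \<in> obs M \<Longrightarrow> set_pmf (q i) = vals M"
    and "interventional_faithfulness M q"
    and "\<epsilon> > 0" and "ancestrality_gap M \<epsilon>"
    and "\<gamma> > 0" and "confounder_gap M \<gamma>"
    and "\<eta> > 0" and "positivity M \<eta>"
    and "dmax \<ge> 1" and "\<And>v. v \<in> obs M \<Longrightarrow> vertex_degree (observable_graph M) v \<le> dmax"
    and "\<And>k W. W \<subseteq> obs M \<Longrightarrow> c k W \<in> assignments M W"
    and "\<And>p I. I \<noteq> {} \<Longrightarrow> sel p I \<in> I"
    and "n = card (obs M)" and "K = dom_size M"
    and "learn = learn_causal_graph (do_dist M) (obs M) K \<epsilon> \<gamma> \<eta> c sel"
  shows
    "(\<forall>\<alpha> \<delta>\<^sub>1 \<delta>\<^sub>2 \<delta>\<^sub>3 \<delta>\<^sub>4 :: real. \<alpha> > 0 \<longrightarrow> \<delta>\<^sub>1 > 0 \<longrightarrow> \<delta>\<^sub>2 > 0 \<longrightarrow> \<delta>\<^sub>3 > 0 \<longrightarrow> \<delta>\<^sub>4 > 0 \<longrightarrow>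
        (let A = size_A n K \<epsilon> \<gamma> \<delta>\<^sub>1; B = size_B n K \<epsilon> \<delta>\<^sub>2; C = size_C n K \<gamma> \<eta> \<delta>\<^sub>3 \<delta>\<^sub>4;
             result = learn \<alpha> dmax \<delta>\<^sub>1 \<delta>\<^sub>2 \<delta>\<^sub>3 \<delta>\<^sub>4
         in measure_pmf.prob result {(G, s). G = causal_graph M}
              \<ge> 1 - 2 / real n powr (\<alpha> / (2 * real dmax) - 2)
                  - 8 * \<alpha> * real dmax * ln (real n) * (real n * \<delta>\<^sub>1 + (\<delta>\<^sub>2 + \<delta>\<^sub>3 + \<delta>\<^sub>4)) \<and>
            (\<forall>(G, s) \<in> set_pmf result.
              real s \<le> 8 * \<alpha> * real dmax * ln (real n) * real (K * A * n + max B C)))) \<and>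
     (\<forall>\<delta> :: real. n \<ge> 2 \<longrightarrow> 0 < \<delta> \<longrightarrow> \<delta> < 1 \<longrightarrow>
        (let \<alpha> = 2 * real dmax * (ln (4 / \<delta>) / ln (real n) + 2);
             \<delta>\<^sub>1 = \<delta> / (64 * \<alpha> * real dmax * real n * ln (real n));
             \<delta>' = \<delta> / (64 * \<alpha> * real dmax * ln (real n))
         in measure_pmf.prob (learn \<alpha> dmax \<delta>\<^sub>1 \<delta>' \<delta>' \<delta>') {(G, s). G = causal_graph M} \<ge> 1 - \<delta>))"
proof -
  interpret L: causal_learning M Y \<epsilon> \<gamma> \<eta> dmax
    by unfold_locales (fact assms)+
  have n1: "1 \<le> real n"
    using L.n_pos \<open>n = card (obs M)\<close> by simp
  have prob: "1 - 2 / real n powr (\<alpha> / (2 * real dmax) - 2)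
      - 8 * \<alpha> * real dmax * ln (real n) * (real n * \<delta>\<^sub>1 + (\<delta>\<^sub>2 + \<delta>\<^sub>3 + \<delta>\<^sub>4))
    \<le> measure_pmf.prob (learn \<alpha> dmax \<delta>\<^sub>1 \<delta>\<^sub>2 \<delta>\<^sub>3 \<delta>\<^sub>4) {(G, s). G = causal_graph M}"
    if "0 < \<alpha>" "0 < \<delta>\<^sub>1" "0 < \<delta>\<^sub>2" "0 < \<delta>\<^sub>3" "0 < \<delta>\<^sub>4" for \<alpha> \<delta>\<^sub>1 \<delta>\<^sub>2 \<delta>\<^sub>3 \<delta>\<^sub>4
    unfolding assms(14-16) using assms(12,13) that by (intro L.learn_causal_graph_prob)
  have samples: "real s \<le> 8 * \<alpha> * real dmax * ln (real n) *
      real (K * size_A n K \<epsilon> \<gamma> \<delta>\<^sub>1 * n + max (size_B n K \<epsilon> \<delta>\<^sub>2) (size_C n K \<gamma> \<eta> \<delta>\<^sub>3 \<delta>\<^sub>4))"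
    if "0 < \<alpha>" and mem: "(G, s) \<in> set_pmf (learn \<alpha> dmax \<delta>\<^sub>1 \<delta>\<^sub>2 \<delta>\<^sub>3 \<delta>\<^sub>4)"
    for \<alpha> \<delta>\<^sub>1 \<delta>\<^sub>2 \<delta>\<^sub>3 \<delta>\<^sub>4 G s
  proof -
    let ?N = "K * size_A n K \<epsilon> \<gamma> \<delta>\<^sub>1 * n + max (size_B n K \<epsilon> \<delta>\<^sub>2) (size_C n K \<gamma> \<eta> \<delta>\<^sub>3 \<delta>\<^sub>4)"
    let ?X = "8 * \<alpha> * real dmax * ln (real n)"
    have "s \<le> nat \<lfloor>?X\<rfloor> * ?N"
      using L.finite_obs assms(13) mem[unfolded assms(14-16) learn_causal_graph_def]
      unfolding assms(14-16) by (rule learn_causal_graph_sized_samples)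
    then have "real s \<le> real (nat \<lfloor>?X\<rfloor>) * real ?N"
      by (metis of_nat_le_iff of_nat_mult)
    also have "\<dots> \<le> ?X * real ?N"
      using that n1 by (intro mult_right_mono of_nat_floor mult_nonneg_nonneg ln_ge_zero) auto
    finally show ?thesis .
  qed
  have final: "measure_pmf.prob (learn \<alpha> dmax \<delta>\<^sub>1 \<delta>' \<delta>' \<delta>') {(G, s). G = causal_graph M} \<ge> 1 - \<delta>"
    if n2: "n \<ge> 2" and \<delta>: "0 < \<delta>" "\<delta> < 1"
      and \<alpha>: "\<alpha> = 2 * real dmax * (ln (4 / \<delta>) / ln (real n) + 2)"
      and \<delta>1: "\<delta>\<^sub>1 = \<delta> / (64 * \<alpha> * real dmax * real n * ln (real n))"
      and \<delta>': "\<delta>' = \<delta> / (64 * \<alpha> * real dmax * ln (real n))"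
    for \<alpha> \<delta> \<delta>\<^sub>1 \<delta>'
  proof -
    have ln: "0 < ln (real n)" using n2 by simp
    have "0 < ln (4 / \<delta>)" using \<delta> by simp
    then have "0 < ln (4 / \<delta>) / ln (real n) + 2"
      using ln by (intro add_pos_pos divide_pos_pos) auto
    then have \<alpha>_pos: "0 < \<alpha>"
      using assms(10) unfolding \<alpha> by (intro mult_pos_pos) auto
    have pos: "0 < \<delta>\<^sub>1" "0 < \<delta>'"
      using ln \<alpha>_pos n2 assms(10) \<delta> unfolding \<delta>1 \<delta>' by (intro divide_pos_pos mult_pos_pos; simp)+
    \<comment> \<open>The \<open>+ 2\<close> in \<alpha> cancels the \<open>- 2\<close> caused by
      the union over pairs, and the remaining power of \<open>n\<close> is
      \<open>4 / \<delta>\<close>, so coverage takes one half of \<delta>.\<close>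
    have "\<alpha> / (2 * real dmax) - 2 = ln (4 / \<delta>) / ln (real n)"
      using assms(10) unfolding \<alpha> by simp
    moreover have "real n powr (ln (4 / \<delta>) / ln (real n)) = 4 / \<delta>"
      using ln n2 \<delta> by (simp add: powr_def)
    ultimately have t1: "2 / real n powr (\<alpha> / (2 * real dmax) - 2) = \<delta> / 2"
      by simp
    \<comment> \<open>Since \<open>real n * \<delta>\<^sub>1 = \<delta>'\<close>, there are four
      equal summands of \<open>\<delta> / 8\<close> each.\<close>
    have "8 * \<alpha> * real dmax * ln (real n) * (real n * \<delta>\<^sub>1 + (\<delta>' + \<delta>' + \<delta>')) = \<delta> / 2"
      using ln \<alpha>_pos n2 assms(10) unfolding \<delta>1 \<delta>' by (simp add: field_simps)
    with t1 prob[OF \<alpha>_pos pos pos(2) pos(2)] show ?thesis by simp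
  qed
  show ?thesis
    unfolding Let_def
  proof (intro conjI allI impI ballI)
    fix \<alpha> \<delta>\<^sub>1 \<delta>\<^sub>2 \<delta>\<^sub>3 \<delta>\<^sub>4 :: real
    assume "\<alpha> > 0" "\<delta>\<^sub>1 > 0" "\<delta>\<^sub>2 > 0" "\<delta>\<^sub>3 > 0" "\<delta>\<^sub>4 > 0"
    then show "measure_pmf.prob (learn \<alpha> dmax \<delta>\<^sub>1 \<delta>\<^sub>2 \<delta>\<^sub>3 \<delta>\<^sub>4) {(G, s). G = causal_graph M}
        \<ge> 1 - 2 / real n powr (\<alpha> / (2 * real dmax) - 2)
            - 8 * \<alpha> * real dmax * ln (real n) * (real n * \<delta>\<^sub>1 + (\<delta>\<^sub>2 + \<delta>\<^sub>3 + \<delta>\<^sub>4))"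
      by (rule prob)
  next
    fix \<alpha> \<delta>\<^sub>1 \<delta>\<^sub>2 \<delta>\<^sub>3 \<delta>\<^sub>4 :: real and r
    assume "\<alpha> > 0" and r: "r \<in> set_pmf (learn \<alpha> dmax \<delta>\<^sub>1 \<delta>\<^sub>2 \<delta>\<^sub>3 \<delta>\<^sub>4)"
    then show "case r of (G, s) \<Rightarrow> real s \<le> 8 * \<alpha> * real dmax * ln (real n) *
        real (K * size_A n K \<epsilon> \<gamma> \<delta>\<^sub>1 * n + max (size_B n K \<epsilon> \<delta>\<^sub>2) (size_C n K \<gamma> \<eta> \<delta>\<^sub>3 \<delta>\<^sub>4))"
      by (cases r) (simp only: prod.case, rule samples)
  next
    fix \<delta> :: real
    assume "n \<ge> 2" "0 < \<delta>" "\<delta> < 1"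
    then show "measure_pmf.prob
        (learn (2 * real dmax * (ln (4 / \<delta>) / ln (real n) + 2)) dmax
          (\<delta> / (64 * (2 * real dmax * (ln (4 / \<delta>) / ln (real n) + 2)) * real dmax * real n * ln (real n)))
          (\<delta> / (64 * (2 * real dmax * (ln (4 / \<delta>) / ln (real n) + 2)) * real dmax * ln (real n)))
          (\<delta> / (64 * (2 * real dmax * (ln (4 / \<delta>) / ln (real n) + 2)) * real dmax * ln (real n)))
          (\<delta> / (64 * (2 * real dmax * (ln (4 / \<delta>) / ln (real n) + 2)) * real dmax * ln (real n))))
        {(G, s). G = causal_graph M} \<ge> 1 - \<delta>"
      by (rule final) (rule refl)+
  qed
qed

end
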